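(* Let $G$ be a finite group with $|G|>2$. Then $G$ is a $CD1$-group with $Z(G)\ne 1$ if and only if $G$ is a $2$-group of central type with $|Z(G)|=2$.
   Context: A finite group $G$ is a $CD1$-group if $|G|>2$ and two columns of its complex character table differ by exactly one entry, i.e. there are non-conjugate $a,b\in G$ and a $\chi\in\mathrm{Irr}(G)$ with $\chi(a)\ne\chi(b)$ and $\psi(a)=\psi(b)$ for all $\psi\in\mathrm{Irr}(G)\setminus\{\chi\}$. A group $G$ is of central type if there is $\chi\in\mathrm{Irr}(G)$ with $[G:Z(G)]=\chi(1)^2$. Here $\mathrm{Irr}(G)$ is the set of complex irreducible characters of $G$. *)

theory Defs
  imports "HOL-Algebra.Coset" "Jordan_Normal_Form.VS_Connect"
begin

definition general_linear_group :: "nat \<Rightarrow> complex mat monoid" where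
  "general_linear_group n = units_of (ring_mat TYPE(complex) n ())"

definition representation :: "('a, 'b) monoid_scheme \<Rightarrow> nat \<Rightarrow> ('a \<Rightarrow> complex mat) \<Rightarrow> bool" where
  "representation G n \<rho> \<longleftrightarrow> \<rho> \<in> hom G (general_linear_group n)"

definition invariant_subspace ::
    "('a, 'b) monoid_scheme \<Rightarrow> nat \<Rightarrow> ('a \<Rightarrow> complex mat) \<Rightarrow> complex vec set \<Rightarrow> bool" where
  "invariant_subspace G n \<rho> W \<longleftrightarrow>
     VectorSpace.subspace class_ring W (module_vec TYPE(complex) n) \<and>
     (\<forall>g \<in> carrier G. \<forall>w \<in> W. \<rho> g *\<^sub>v w \<in> W)"

definition irreducible_representation ::
    "('a, 'b) monoid_scheme \<Rightarrow> nat \<Rightarrow> ('a \<Rightarrow> complex mat) \<Rightarrow> bool" where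
  "irreducible_representation G n \<rho> \<longleftrightarrow>
     representation G n \<rho> \<and> n > 0 \<and>
     (\<forall>W. invariant_subspace G n \<rho> W \<longrightarrow> W = {0\<^sub>v n} \<or> W = carrier_vec n)"

definition mat_trace :: "complex mat \<Rightarrow> complex" where
  "mat_trace A = (\<Sum>i<dim_row A. A $$ (i, i))"

text \<open>Characters are made undefined outside \<open>carrier G\<close>, so that two characters are equal
  as HOL functions exactly when they agree on the group.\<close>

definition character_of ::
    "('a, 'b) monoid_scheme \<Rightarrow> ('a \<Rightarrow> complex mat) \<Rightarrow> 'a \<Rightarrow> complex" where
  "character_of G \<rho> = (\<lambda>g \<in> carrier G. mat_trace (\<rho> g))"

definition Irr :: "('a, 'b) monoid_scheme \<Rightarrow> ('a \<Rightarrow> complex) set" where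
  "Irr G = {character_of G \<rho> | n \<rho>. irreducible_representation G n \<rho>}"

definition center :: "('a, 'b) monoid_scheme \<Rightarrow> 'a set" where
  "center G = {z \<in> carrier G. \<forall>g \<in> carrier G. z \<otimes>\<^bsub>G\<^esub> g = g \<otimes>\<^bsub>G\<^esub> z}"

definition conjugate_in :: "('a, 'b) monoid_scheme \<Rightarrow> 'a \<Rightarrow> 'a \<Rightarrow> bool" where
  "conjugate_in G a b \<longleftrightarrow> (\<exists>g \<in> carrier G. b = g \<otimes>\<^bsub>G\<^esub> a \<otimes>\<^bsub>G\<^esub> inv\<^bsub>G\<^esub> g)"

definition CD1_group :: "('a, 'b) monoid_scheme \<Rightarrow> bool" where
  "CD1_group G \<longleftrightarrow>
     group G \<and> finite (carrier G) \<and> Coset.order G > 2 \<and>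
     (\<exists>a \<in> carrier G. \<exists>b \<in> carrier G. \<exists>\<chi> \<in> Irr G.
        \<not> conjugate_in G a b \<and> \<chi> a \<noteq> \<chi> b \<and> (\<forall>\<psi> \<in> Irr G - {\<chi>}. \<psi> a = \<psi> b))"

definition central_type :: "('a, 'b) monoid_scheme \<Rightarrow> bool" where
  "central_type G \<longleftrightarrow>
     (\<exists>\<chi> \<in> Irr G. of_nat (card (rcosets\<^bsub>G\<^esub> (center G))) = (\<chi> \<one>\<^bsub>G\<^esub>)\<^sup>2)"

definition two_group :: "('a, 'b) monoid_scheme \<Rightarrow> bool" where
  "two_group G \<longleftrightarrow> group G \<and> (\<exists>k. Coset.order G = 2 ^ k)"

end

theory Submission
  imports Defs
    "Jordan_Normal_Form.Spectral_Radius"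
    "HOL-Algebra.Sylow"
    "HOL-Algebra.Multiplicative_Group"
begin

text \<open>
  Write \<open>Z\<close> for the center and call two group elements a CD1 pair for \<open>\<chi>\<close> if \<open>\<chi>\<close> is the only
  irreducible character that takes different values on them.

  Suppose that \<open>(a, b)\<close> is a CD1 pair for \<open>\<chi>\<close>. Let \<open>n\<^sub>a(g)\<close> be the number of \<open>x\<close> with
  \<open>x a x\<^sup>-\<^sup>1 = g\<close>. The class function \<open>n\<^sub>a - n\<^sub>b\<close> pairs with an irreducible character \<open>\<psi>\<close> to
  \<open>|G| (\<psi>(a) - \<psi>(b))\<close>, which vanishes for \<open>\<psi> \<noteq> \<chi>\<close>. Irreducible characters are orthogonal and span
  the class functions, so \<open>n\<^sub>a(g) - n\<^sub>b(g) = (\<chi>(a) - \<chi>(b)) \<chi>(g\<^sup>-\<^sup>1)\<close> (lemma \<open>column_difference\<close>):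
  \<open>\<chi>\<close> lives on the classes of \<open>a\<close> and \<open>b\<close> up to inversion. As \<open>\<chi>(1) \<noteq> 0\<close>, one of the two elements
  is 1, say \<open>a = 1\<close>. A central \<open>z\<close> acts by a nonzero scalar, so \<open>\<chi>(z) \<noteq> 0\<close>; hence a nontrivial
  center is exactly \<open>{1, b}\<close>, and reading off the values gives \<open>\<chi>(b) = - \<chi>(1)\<close>, \<open>\<chi> = 0\<close> off \<open>Z\<close> and
  \<open>|G| = 2 \<chi>(1)\<^sup>2\<close> (lemma \<open>CD1_pair_with_one\<close>). So \<open>G\<close> is of central type.

  Such a \<open>G\<close> is a 2-group. For an odd prime \<open>p\<close>, a Sylow \<open>p\<close>-subgroup \<open>P\<close> meets \<open>Z\<close> trivially,
  so \<open>\<chi>\<close> vanishes on \<open>P - {1}\<close> and the multiplicity of the trivial character in the restriction of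
  \<open>\<chi>\<close> to \<open>P\<close> is \<open>\<chi>(1) / |P|\<close>. Thus \<open>|P|\<close> divides \<open>\<chi>(1)\<close>, hence \<open>|P|\<^sup>2\<close> divides
  \<open>2 \<chi>(1)\<^sup>2 = |G|\<close>, and \<open>P\<close> is trivial.

  Conversely let \<open>Z = {1, z}\<close> and \<open>\<chi>(1)\<^sup>2 = [G:Z]\<close>. In \<open>\<Sum>\<^sub>g |\<chi>(g)|\<^sup>2 = |G|\<close> the two central
  terms already contribute \<open>2 \<chi>(1)\<^sup>2 = |G|\<close>, so \<open>\<chi>\<close> vanishes off \<open>Z\<close>. Orthogonality to the trivial
  character forces \<open>\<chi>(z) = - \<chi>(1)\<close>, and then orthogonality of any other irreducible \<open>\<psi>\<close> to \<open>\<chi>\<close>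
  says \<open>\<psi>(1) = \<psi>(z)\<close>: \<open>(1, z)\<close> is a CD1 pair for \<open>\<chi>\<close>.

  The character theory behind this is developed for matrix representations. Orthogonality comes from
  Schur's lemma applied to averages over the group. For the spanning property, block
  triangulation shows that the trace of any representation is a sum of irreducible characters, and the
  regular representation then detects the value of a function at 1.
\<close>

section \<open>Traces and sums of matrices\<close>

lemma mat_trace_eq_sum: "A \<in> carrier_mat n m \<Longrightarrow> mat_trace A = (\<Sum>i<n. A $$ (i, i))"
  by (simp add: mat_trace_def)

lemma mat_trace_one: "mat_trace (1\<^sub>m n) = of_nat n"
  by (simp add: mat_trace_def)

lemma mat_trace_smult_one: "mat_trace (c \<cdot>\<^sub>m 1\<^sub>m n) = c * of_nat n"
  by (simp add: mat_trace_def)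

lemma mat_trace_smult: "M \<in> carrier_mat n n \<Longrightarrow> mat_trace (c \<cdot>\<^sub>m M) = c * mat_trace M"
  by (simp add: mat_trace_def sum_distrib_left)

lemma index_mult_mat_sum:
  fixes A B :: "'a :: semiring_0 mat"
  assumes "A \<in> carrier_mat n k" "B \<in> carrier_mat k m" "i < n" "j < m"
  shows "(A * B) $$ (i, j) = (\<Sum>l<k. A $$ (i, l) * B $$ (l, j))"
  using assms by (auto simp: scalar_prod_def atLeast0LessThan intro!: sum.cong)

lemma mult_mat_vec_sum:
  assumes "A \<in> carrier_mat n m" "v \<in> carrier_vec m" "i < n"
  shows "(A *\<^sub>v v) $ i = (\<Sum>l<m. A $$ (i, l) * v $ l)"
  using assms by (auto simp: scalar_prod_def atLeast0LessThan intro!: sum.cong)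

lemma mat_trace_mult_comm:
  assumes "A \<in> carrier_mat n m" "B \<in> carrier_mat m n"
  shows "mat_trace (A * B) = mat_trace (B * A)"
proof -
  have "mat_trace (A * B) = (\<Sum>i<n. \<Sum>l<m. A $$ (i, l) * B $$ (l, i))"
    using assms by (simp add: mat_trace_eq_sum[of _ n n] index_mult_mat_sum[OF assms] del: index_mult_mat(1))
  also have "\<dots> = (\<Sum>l<m. \<Sum>i<n. B $$ (l, i) * A $$ (i, l))"
    by (subst sum.swap) (simp add: mult.commute)
  also have "\<dots> = mat_trace (B * A)"
    using assms by (simp add: mat_trace_eq_sum[of _ m m] index_mult_mat_sum[OF assms(2,1)] del: index_mult_mat(1))
  finally show ?thesis .
qed

lemma mat_trace_conjugate:
  assumes "P \<in> carrier_mat n n" "Q \<in> carrier_mat n n" "A \<in> carrier_mat n n" "Q * P = 1\<^sub>m n"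
  shows "mat_trace (P * A * Q) = mat_trace A"
proof -
  have "mat_trace (P * A * Q) = mat_trace (Q * (P * A))"
    using assms by (intro mat_trace_mult_comm[of _ n n]) auto
  also have "Q * (P * A) = (Q * P) * A"
    using assms by (metis assoc_mult_mat)
  finally show ?thesis
    using assms by simp
qed

lemma mat_eqI_mult_vec:
  fixes A B :: "complex mat"
  assumes "A \<in> carrier_mat n m" "B \<in> carrier_mat n m"
    and "\<And>v. v \<in> carrier_vec m \<Longrightarrow> A *\<^sub>v v = B *\<^sub>v v"
  shows "A = B"
proof (rule eq_matI)
  fix i j assume ij: "i < dim_row B" "j < dim_col B"
  then have "(A *\<^sub>v unit_vec m j) $ i = (B *\<^sub>v unit_vec m j) $ i"
    using assms by simp
  then show "A $$ (i, j) = B $$ (i, j)" using assms(1,2) ij by simp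
qed (use assms in auto)

lemma diff_add_cancel_vec:
  fixes v w :: "complex vec"
  assumes "v \<in> carrier_vec n" "w \<in> carrier_vec n"
  shows "v - w + w = v"
  using assms by (intro eq_vecI) auto

lemma mat_inverse_exists:
  fixes Q :: "complex mat"
  assumes "Q \<in> carrier_mat n n" "det Q \<noteq> 0"
  obtains P where "P \<in> carrier_mat n n" "P * Q = 1\<^sub>m n" "Q * P = 1\<^sub>m n"
  using det_non_zero_imp_unit[OF assms, of "()"] by (auto simp: Units_def ring_mat_simps)

text \<open>
  The plain sum operator is of no use here: matrices of all sizes share one type, so that type has no
  neutral element. The size is therefore an argument, and the sum is taken entrywise.
\<close>

definition mat_sum :: "nat \<Rightarrow> nat \<Rightarrow> ('a \<Rightarrow> complex mat) \<Rightarrow> 'a set \<Rightarrow> complex mat" where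
  "mat_sum n m F S = mat n m (\<lambda>ij. \<Sum>g\<in>S. F g $$ ij)"

lemma mat_sum_carrier [simp]: "mat_sum n m F S \<in> carrier_mat n m"
  by (simp add: mat_sum_def)

lemma mat_sum_index [simp]: "i < n \<Longrightarrow> j < m \<Longrightarrow> mat_sum n m F S $$ (i, j) = (\<Sum>g\<in>S. F g $$ (i, j))"
  by (simp add: mat_sum_def)

lemma mat_sum_dim [simp]: "dim_row (mat_sum n m F S) = n" "dim_col (mat_sum n m F S) = m"
  by (simp_all add: mat_sum_def)

lemma mat_sum_cong: "(\<And>g. g \<in> S \<Longrightarrow> F g = F' g) \<Longrightarrow> mat_sum n m F S = mat_sum n m F' S"
  by (rule eq_matI) auto

lemma mat_sum_reindex:
  "bij_betw f S T \<Longrightarrow> mat_sum n m F T = mat_sum n m (\<lambda>g. F (f g)) S"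
  by (rule eq_matI) (auto intro!: sum.reindex_bij_betw[symmetric])

lemma mult_mat_sum:
  assumes "A \<in> carrier_mat p n" "\<And>g. g \<in> S \<Longrightarrow> F g \<in> carrier_mat n m"
  shows "A * mat_sum n m F S = mat_sum p m (\<lambda>g. A * F g) S"
proof (rule eq_matI)
  fix i j assume "i < dim_row (mat_sum p m (\<lambda>g. A * F g) S)" "j < dim_col (mat_sum p m (\<lambda>g. A * F g) S)"
  then have ij: "i < p" "j < m" by auto
  have "(A * mat_sum n m F S) $$ (i, j) = (\<Sum>l<n. \<Sum>g\<in>S. A $$ (i, l) * F g $$ (l, j))"
    using ij by (subst index_mult_mat_sum[OF assms(1) mat_sum_carrier ij]) (simp add: sum_distrib_left)
  also have "\<dots> = (\<Sum>g\<in>S. (A * F g) $$ (i, j))"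
    by (subst sum.swap) (auto simp del: index_mult_mat(1) simp: index_mult_mat_sum[OF assms(1) assms(2) ij])
  finally show "(A * mat_sum n m F S) $$ (i, j) = mat_sum p m (\<lambda>g. A * F g) S $$ (i, j)"
    using ij by simp
qed (use assms in auto)

lemma mat_sum_mult:
  assumes "A \<in> carrier_mat m p" "\<And>g. g \<in> S \<Longrightarrow> F g \<in> carrier_mat n m"
  shows "mat_sum n m F S * A = mat_sum n p (\<lambda>g. F g * A) S"
proof (rule eq_matI)
  fix i j assume "i < dim_row (mat_sum n p (\<lambda>g. F g * A) S)" "j < dim_col (mat_sum n p (\<lambda>g. F g * A) S)"
  then have ij: "i < n" "j < p" by auto
  have "(mat_sum n m F S * A) $$ (i, j) = (\<Sum>l<m. \<Sum>g\<in>S. F g $$ (i, l) * A $$ (l, j))"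
    using ij by (subst index_mult_mat_sum[OF mat_sum_carrier assms(1) ij]) (simp add: sum_distrib_right)
  also have "\<dots> = (\<Sum>g\<in>S. (F g * A) $$ (i, j))"
    by (subst sum.swap) (auto simp del: index_mult_mat(1) simp: index_mult_mat_sum[OF assms(2) assms(1) ij])
  finally show "(mat_sum n m F S * A) $$ (i, j) = mat_sum n p (\<lambda>g. F g * A) S $$ (i, j)"
    using ij by simp
qed (use assms in auto)

lemma mat_trace_mat_sum:
  assumes "\<And>g. g \<in> S \<Longrightarrow> F g \<in> carrier_mat n n"
  shows "mat_trace (mat_sum n n F S) = (\<Sum>g\<in>S. mat_trace (F g))"
proof -
  have "mat_trace (mat_sum n n F S) = (\<Sum>i<n. \<Sum>g\<in>S. F g $$ (i, i))"
    by (simp add: mat_trace_def)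
  also have "\<dots> = (\<Sum>g\<in>S. mat_trace (F g))"
    by (subst sum.swap) (use assms in \<open>auto simp: mat_trace_eq_sum[of _ n n] intro!: sum.cong\<close>)
  finally show ?thesis .
qed

text \<open>
  The matrix units \<open>E\<^sub>i\<^sub>j\<close>. Sandwiched between two representing matrices they pick out a product of
  two matrix coefficients, which is how Schur's lemma is turned into statements about characters.
\<close>

definition matrix_unit :: "nat \<Rightarrow> nat \<Rightarrow> nat \<Rightarrow> nat \<Rightarrow> complex mat" where
  "matrix_unit n m i j = mat n m (\<lambda>(p, q). if p = i \<and> q = j then 1 else 0)"

lemma matrix_unit_carrier [simp]: "matrix_unit n m i j \<in> carrier_mat n m"
  by (simp add: matrix_unit_def)

lemma mult_matrix_unit_mult:
  assumes A: "A \<in> carrier_mat n n" and B: "B \<in> carrier_mat m m"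
    and "i < n" "j < m" "a < n" "b < m"
  shows "(A * matrix_unit n m i j * B) $$ (a, b) = A $$ (a, i) * B $$ (j, b)"
proof -
  have 1: "(A * matrix_unit n m i j) $$ (a, q) = (if q = j then A $$ (a, i) else 0)" if "q < m" for q
    using assms that by (subst index_mult_mat_sum[OF A matrix_unit_carrier])
      (auto simp: matrix_unit_def if_distrib sum.delta cong: if_cong)
  have "A * matrix_unit n m i j \<in> carrier_mat n m" using A by auto
  from index_mult_mat_sum[OF this B \<open>a < n\<close> \<open>b < m\<close>]
  have "(A * matrix_unit n m i j * B) $$ (a, b) = (\<Sum>q<m. (if q = j then A $$ (a, i) else 0) * B $$ (q, b))"
    by (simp add: 1 del: index_mult_mat(1))
  also have "\<dots> = (\<Sum>q<m. if q = j then A $$ (a, i) * B $$ (q, b) else 0)"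
    by (intro sum.cong) auto
  finally show ?thesis using \<open>j < m\<close> by (simp add: sum.delta)
qed

lemma mat_trace_matrix_unit: "i < n \<Longrightarrow> mat_trace (matrix_unit n n i j) = (if i = j then 1 else 0)"
  by (auto simp: mat_trace_def matrix_unit_def if_distrib cong: if_cong)

section \<open>Traces of matrices of finite order and of idempotents\<close>

lemma complex_triangulation:
  fixes A :: "complex mat"
  assumes A: "A \<in> carrier_mat n n"
  obtains B P Q where "similar_mat_wit A B P Q" "upper_triangular B" "B \<in> carrier_mat n n"
proof -
  obtain es where "char_poly A = (\<Prod>a\<leftarrow>es. [:- a, 1:])"
    using char_poly_factorized[OF A] by auto
  from schur_decomposition_exists[OF A this] that show ?thesis
    unfolding similar_mat_def by blast
qed

lemma upper_triangular_mult:
  fixes A B :: "complex mat"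
  assumes "A \<in> carrier_mat n n" "B \<in> carrier_mat n n" "upper_triangular A" "upper_triangular B"
  shows "upper_triangular (A * B)"
    and "i < n \<Longrightarrow> (A * B) $$ (i, i) = A $$ (i, i) * B $$ (i, i)"
proof -
  have z: "A $$ (i, l) = 0 \<or> B $$ (l, j) = 0" if "j \<le> i" "l \<noteq> i \<or> j < i" "i < n" "l < n" for i j l
    using that assms by (cases "l < i") (auto simp: upper_triangular_def)
  show "upper_triangular (A * B)"
  proof (rule upper_triangularI)
    fix i j assume "j < i" "i < dim_row (A * B)"
    then have ij: "j < i" "i < n" "j < n" using assms by auto
    have "(A * B) $$ (i, j) = (\<Sum>l<n. A $$ (i, l) * B $$ (l, j))"
      using ij(2,3) by (rule index_mult_mat_sum[OF assms(1,2)])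
    also have "\<dots> = 0"
      using z[OF less_imp_le[OF ij(1)] disjI2[OF ij(1)] ij(2)] by (intro sum.neutral) simp
    finally show "(A * B) $$ (i, j) = 0" .
  qed
  assume i: "i < n"
  have "(A * B) $$ (i, i) = (\<Sum>l<n. A $$ (i, l) * B $$ (l, i))"
    using i i by (rule index_mult_mat_sum[OF assms(1,2)])
  also have "\<dots> = (\<Sum>l\<in>{i}. A $$ (i, l) * B $$ (l, i))"
    using i z[OF order.refl disjI1 i] by (intro sum.mono_neutral_right) auto
  finally show "(A * B) $$ (i, i) = A $$ (i, i) * B $$ (i, i)" by simp
qed

lemma upper_triangular_pow:
  fixes B :: "complex mat"
  assumes "B \<in> carrier_mat n n" "upper_triangular B"
  shows "upper_triangular (B ^\<^sub>m k) \<and> (\<forall>i<n. (B ^\<^sub>m k) $$ (i, i) = (B $$ (i, i)) ^ k)"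
proof (induction k)
  case (Suc k)
  then show ?case
    using upper_triangular_mult[OF _ assms(1) _ assms(2), of "B ^\<^sub>m k"] assms by auto
qed (use assms in auto)

text \<open>
  After triangulation the diagonal of a power consists of the powers of the diagonal, and the
  relation \<open>A\<^sup>k = 1\<close> passes to every diagonal entry.
\<close>

lemma mat_trace_eq_sum_roots_of_unity:
  fixes A :: "complex mat"
  assumes A: "A \<in> carrier_mat n n" and k: "A ^\<^sub>m k = 1\<^sub>m n"
  shows "\<exists>\<mu>. (\<forall>j. mat_trace (A ^\<^sub>m j) = (\<Sum>i<n. \<mu> i ^ j)) \<and> (\<forall>i<n. \<mu> i ^ k = 1)"
proof -
  obtain B P Q where sim: "similar_mat_wit A B P Q" and up: "upper_triangular B"
    and B: "B \<in> carrier_mat n n"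
    by (rule complex_triangulation[OF A])
  note w = similar_mat_witD2[OF A sim]
  have diag: "(B ^\<^sub>m j) $$ (i, i) = (B $$ (i, i)) ^ j" if "i < n" for i j
    using upper_triangular_pow[OF B up] that by auto
  have "mat_trace (A ^\<^sub>m j) = (\<Sum>i<n. (B $$ (i, i)) ^ j)" for j
  proof -
    have "mat_trace (A ^\<^sub>m j) = mat_trace (B ^\<^sub>m j)"
      using w by (subst similar_mat_wit_pow_id[OF sim], subst mat_trace_conjugate[of _ n]) auto
    also have "\<dots> = (\<Sum>i<n. (B $$ (i, i)) ^ j)"
      using B by (subst mat_trace_eq_sum[of _ n n]) (auto simp: diag)
    finally show ?thesis .
  qed
  moreover have "(B $$ (i, i)) ^ k = 1" if "i < n" for i
  proof -
    have "B ^\<^sub>m k = Q * A ^\<^sub>m k * P"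
      by (rule similar_mat_wit_pow_id[OF similar_mat_wit_sym[OF sim]])
    also have "\<dots> = 1\<^sub>m n" using k w by simp
    finally show ?thesis using diag[OF that, of k] that by simp
  qed
  ultimately show ?thesis by (intro exI[of _ "\<lambda>i. B $$ (i, i)"]) auto
qed

text \<open>
  The exponent \<open>k\<close> stands for \<open>-1\<close>. The eigenvalues are roots of unity, and a root of unity has its
  conjugate as inverse.
\<close>

lemma cnj_mat_trace_finite_order:
  fixes A :: "complex mat"
  assumes A: "A \<in> carrier_mat n n" and k: "A ^\<^sub>m Suc k = 1\<^sub>m n"
  shows "mat_trace (A ^\<^sub>m k) = cnj (mat_trace A)"
proof -
  obtain \<mu> where tr: "\<And>j. mat_trace (A ^\<^sub>m j) = (\<Sum>i<n. \<mu> i ^ j)"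
    and 1: "\<And>i. i < n \<Longrightarrow> \<mu> i ^ Suc k = 1"
    using mat_trace_eq_sum_roots_of_unity[OF A k] by blast
  have "\<mu> i ^ k = cnj (\<mu> i)" if "i < n" for i
  proof -
    have "norm (\<mu> i) = 1" using power_eq_1_iff[OF 1[OF that]] by simp
    then have "\<mu> i * cnj (\<mu> i) = 1" by (simp flip: complex_norm_square)
    moreover have "\<mu> i * \<mu> i ^ k = 1" using 1[OF that] by simp
    ultimately show ?thesis
      by (metis mult.assoc mult.commute mult.right_neutral)
  qed
  moreover have "mat_trace A = (\<Sum>i<n. \<mu> i)" using tr[of 1] A by simp
  ultimately show ?thesis by (simp add: tr)
qed

lemma sum_Nats: "(\<And>i. i \<in> S \<Longrightarrow> f i \<in> \<nat>) \<Longrightarrow> sum f S \<in> \<nat>"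
  by (induction S rule: infinite_finite_induct) auto

text \<open>
  The diagonal of a triangular form of an idempotent consists of zeros and ones. (The trace is the
  rank.) This is the source of integrality for multiplicities of characters.
\<close>

lemma mat_trace_idempotent:
  fixes A :: "complex mat"
  assumes A: "A \<in> carrier_mat n n" and idem: "A * A = A"
  shows "mat_trace A \<in> \<nat>"
proof -
  obtain B P Q where sim: "similar_mat_wit A B P Q" and up: "upper_triangular B"
    and B: "B \<in> carrier_mat n n"
    by (rule complex_triangulation[OF A])
  note w = similar_mat_witD2[OF A sim]
  have A2: "A ^\<^sub>m 2 = A" using A idem by (simp add: numeral_2_eq_2)
  have "B ^\<^sub>m 2 = Q * A ^\<^sub>m 2 * P"
    by (rule similar_mat_wit_pow_id[OF similar_mat_wit_sym[OF sim]])
  also have "\<dots> = B"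
    unfolding A2 using similar_mat_witD2(3)[OF B similar_mat_wit_sym[OF sim]] by simp
  finally have "B $$ (i, i) ^ 2 = B $$ (i, i)" if "i < n" for i
    using upper_triangular_pow[OF B up, of 2] that by simp
  note sq = this
  have "B $$ (i, i) \<in> \<nat>" if "i < n" for i
  proof -
    have "B $$ (i, i) = 0 \<or> B $$ (i, i) = 1"
      using sq[OF that] by (simp add: power2_eq_square)
    then show ?thesis by (elim disjE) (simp_all only: Nats_0 Nats_1)
  qed
  moreover have "mat_trace A = (\<Sum>i<n. B $$ (i, i))"
    unfolding w(3) mat_trace_conjugate[OF w(6,7,5,2)] by (rule mat_trace_eq_sum[OF B])
  ultimately show ?thesis by (auto intro!: sum_Nats)
qed

section \<open>Coordinates adapted to a subspace\<close>

text \<open>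
  Every subspace is cut out by the vanishing of the last coordinates after an invertible change of
  coordinates \<open>Q\<close>. Take \<open>k\<close> maximal such that the first \<open>k\<close> coordinate directions of some \<open>Q\<close>
  lie in \<open>W\<close>. If a vector of \<open>W\<close> had a further nonzero coordinate, it could replace one of the
  remaining directions, and \<open>k\<close> would not be maximal.
\<close>

lemma adapted_coordinates:
  fixes W :: "complex vec set"
  assumes sub: "W \<subseteq> carrier_vec n" and zero: "0\<^sub>v n \<in> W"
    and add: "\<And>v w. v \<in> W \<Longrightarrow> w \<in> W \<Longrightarrow> v + w \<in> W"
    and smult: "\<And>c v. v \<in> W \<Longrightarrow> c \<cdot>\<^sub>v v \<in> W"
  obtains k Q where "k \<le> n" "Q \<in> carrier_mat n n" "det Q \<noteq> 0"
    "W = {v \<in> carrier_vec n. \<forall>i\<in>{k..<n}. (Q *\<^sub>v v) $ i = 0}"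
proof -
  define adapted where "adapted k Q \<longleftrightarrow> Q \<in> carrier_mat n n \<and> det Q \<noteq> 0 \<and>
    {v \<in> carrier_vec n. \<forall>i\<in>{k..<n}. (Q *\<^sub>v v) $ i = 0} \<subseteq> W" for k Q
  have "v = 0\<^sub>v n" if "v \<in> carrier_vec n" "\<forall>i\<in>{0..<n}. (1\<^sub>m n *\<^sub>v v) $ i = 0" for v :: "complex vec"
    using that by auto
  then have "adapted 0 (1\<^sub>m n)" unfolding adapted_def using zero by auto
  then have "\<exists>k. (\<exists>Q. adapted k Q) \<and> k \<le> n" by blast
  then obtain k where k: "\<exists>Q. adapted k Q" "k \<le> n"
    and max: "\<And>k'. (\<exists>Q. adapted k' Q) \<Longrightarrow> k' \<le> n \<Longrightarrow> k' \<le> k"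
    using Greatest_le_nat[of "\<lambda>k. (\<exists>Q. adapted k Q) \<and> k \<le> n" _ n]
      GreatestI_ex_nat[of "\<lambda>k. (\<exists>Q. adapted k Q) \<and> k \<le> n" n] by blast
  from k(1) obtain Q where "adapted k Q" by blast
  then have Q: "Q \<in> carrier_mat n n" "det Q \<noteq> 0"
    and in_W: "\<And>v. v \<in> carrier_vec n \<Longrightarrow> (\<And>i. k \<le> i \<Longrightarrow> i < n \<Longrightarrow> (Q *\<^sub>v v) $ i = 0) \<Longrightarrow> v \<in> W"
    by (auto simp: adapted_def)
  have "(Q *\<^sub>v w) $ j = 0" if w: "w \<in> W" and j: "k \<le> j" "j < n" for w j
  proof (rule ccontr)
    define u where "u = Q *\<^sub>v w"
    assume "(Q *\<^sub>v w) $ j \<noteq> 0"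
    then have uj: "u $ j \<noteq> 0" by (simp add: u_def)
    \<comment> \<open>Exchange the coordinates \<open>j\<close> and \<open>k\<close>, then subtract multiples of the new coordinate \<open>k\<close>
      from the later ones so that \<open>w\<close> has no coordinate beyond \<open>k\<close>.\<close>
    define s where "s = Transposition.transpose j k"
    have s: "s i < n" if "i < n" for i using that j by (auto simp: s_def Transposition.transpose_def)
    have ss: "s (s i) = i" for i by (simp add: s_def)
    define c where "c i = (if k < i then u $ s i / u $ j else 0)" for i
    define Q' where "Q' = mat n n (\<lambda>(i, l). Q $$ (s i, l) - c i * Q $$ (j, l))"
    have Q': "Q' \<in> carrier_mat n n" by (simp add: Q'_def)
    have Q'v: "(Q' *\<^sub>v v) $ i = (Q *\<^sub>v v) $ s i - c i * (Q *\<^sub>v v) $ j"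
      if "v \<in> carrier_vec n" "i < n" for v i
      unfolding mult_mat_vec_sum[OF Q' that] mult_mat_vec_sum[OF Q(1) that(1) s[OF that(2)]]
        mult_mat_vec_sum[OF Q(1) that(1) j(2)]
      using that by (simp add: Q'_def sum_subtractf sum_distrib_left left_diff_distrib mult.assoc)
    have sk: "s k = j" and ck: "c k = 0" by (auto simp: s_def c_def)
    have "det Q' \<noteq> 0"
    proof
      assume "det Q' = 0"
      then obtain v where v: "v \<in> carrier_vec n" "v \<noteq> 0\<^sub>v n" "Q' *\<^sub>v v = 0\<^sub>v n"
        using det_0_iff_vec_prod_zero_field[OF Q'] by blast
      have "(Q *\<^sub>v v) $ j = 0"
        using Q'v[OF v(1), of k] v(3) j by (simp add: sk ck)
      then have "(Q *\<^sub>v v) $ s i = 0" if "i < n" for i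
        using Q'v[OF v(1) that] v(3) that by simp
      from this[OF s] have "(Q *\<^sub>v v) $ i = 0" if "i < n" for i
        using that by (simp add: ss)
      then have "Q *\<^sub>v v = 0\<^sub>v n" using Q by (intro eq_vecI) auto
      then show False using det_0_iff_vec_prod_zero_field[OF Q(1)] v Q by blast
    qed
    moreover have "v \<in> W" if v: "v \<in> carrier_vec n" "\<And>i. Suc k \<le> i \<Longrightarrow> i < n \<Longrightarrow> (Q' *\<^sub>v v) $ i = 0" for v
    proof -
      have wc: "w \<in> carrier_vec n" using w sub by auto
      \<comment> \<open>Removing a multiple of \<open>w\<close> from \<open>v\<close> leaves a vector in the span of the first \<open>k\<close>
        directions of \<open>Q\<close>.\<close>
      define a where "a = (Q *\<^sub>v v) $ j / u $ j"
      define v' where "v' = v + (- a) \<cdot>\<^sub>v w"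
      have "v' \<in> W"
      proof (rule in_W)
        show "v' \<in> carrier_vec n" using v wc by (simp add: v'_def)
        fix i assume i: "k \<le> i" "i < n"
        have Qv': "(Q *\<^sub>v v') $ i = (Q *\<^sub>v v) $ i - a * u $ i" if "i < n" for i
          using that v wc Q unfolding v'_def u_def
          by (subst mult_add_distrib_mat_vec[of _ n n], simp_all add: mult_mat_vec[of _ n n])
        show "(Q *\<^sub>v v') $ i = 0"
        proof (cases "i = j")
          case True
          then show ?thesis using Qv'[OF i(2)] uj by (simp add: a_def)
        next
          case False
          then have "k < s i" using i j by (auto simp: s_def Transposition.transpose_def)
          then have "(Q *\<^sub>v v) $ i - c (s i) * (Q *\<^sub>v v) $ j = 0"
            using Q'v[OF v(1) s[OF i(2)]] v(2)[of "s i"] s[OF i(2)] by (simp add: ss)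
          then show ?thesis using Qv'[OF i(2)] \<open>k < s i\<close> by (simp add: c_def ss a_def mult.commute)
        qed
      qed
      then have "v' + a \<cdot>\<^sub>v w \<in> W" using w add smult by blast
      moreover have "v' + a \<cdot>\<^sub>v w = v" using v wc by (intro eq_vecI) (auto simp: v'_def)
      ultimately show ?thesis by simp
    qed
    ultimately have "adapted (Suc k) Q'"
      using Q' by (auto simp: adapted_def)
    then show False using max[of "Suc k"] j by auto
  qed
  then have "W = {v \<in> carrier_vec n. \<forall>i\<in>{k..<n}. (Q *\<^sub>v v) $ i = 0}"
    using sub in_W by auto
  with k(2) Q show ?thesis by (rule that)
qed

section \<open>Matrix representations and Schur's lemma\<close>

lemma invariant_subspace_iff:
  "invariant_subspace G n \<rho> W \<longleftrightarrow> W \<subseteq> carrier_vec n \<and> 0\<^sub>v n \<in> W \<and>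
     (\<forall>v\<in>W. \<forall>w\<in>W. v + w \<in> W) \<and> (\<forall>c. \<forall>v\<in>W. c \<cdot>\<^sub>v v \<in> W) \<and>
     (\<forall>g\<in>carrier G. \<forall>w\<in>W. \<rho> g *\<^sub>v w \<in> W)"
  using vec_module[where 'a=complex and n=n] vec_vs[where 'a=complex and n=n]
  by (auto simp: invariant_subspace_def VectorSpace.subspace_def submodule_def module_vec_simps class_ring_simps)

locale finite_group = group G for G (structure) +
  assumes finite_carrier: "finite (carrier G)"
begin

text \<open>
  Invertibility of the representing matrices is equivalent to the condition at the neutral element,
  because an invertible idempotent is the identity. In this form representations can be built from
  their matrices.
\<close>

lemma representation_iff:
  "representation G n \<rho> \<longleftrightarrow> (\<forall>g\<in>carrier G. \<rho> g \<in> carrier_mat n n) \<and>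
     (\<forall>g\<in>carrier G. \<forall>h\<in>carrier G. \<rho> (g \<otimes> h) = \<rho> g * \<rho> h) \<and> \<rho> \<one> = 1\<^sub>m n"
  (is "_ \<longleftrightarrow> ?R")
proof
  assume rep: "representation G n \<rho>"
  then have hom: "\<rho> g \<in> Units (ring_mat TYPE(complex) n ())" "\<rho> (g \<otimes> h) = \<rho> g * \<rho> h"
    if "g \<in> carrier G" "h \<in> carrier G" for g h
    using that by (auto simp: representation_def hom_def general_linear_group_def units_of_def ring_mat_simps)
  then have carr: "\<rho> g \<in> carrier_mat n n" if "g \<in> carrier G" for g
    using that by (auto simp: Units_def ring_mat_simps)
  obtain Y where Y: "Y \<in> carrier_mat n n" "Y * \<rho> \<one> = 1\<^sub>m n"
    using hom(1)[of \<one> \<one>] by (auto simp: Units_def ring_mat_simps)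
  have "\<rho> \<one> = (Y * \<rho> \<one>) * \<rho> \<one>" using carr[of \<one>] Y by simp
  also have "\<dots> = Y * (\<rho> \<one> * \<rho> \<one>)" using carr[of \<one>] Y by (intro assoc_mult_mat) auto
  also have "\<rho> \<one> * \<rho> \<one> = \<rho> \<one>" using hom(2)[of \<one> \<one>] by simp
  finally have "\<rho> \<one> = 1\<^sub>m n" using Y by simp
  then show ?R using hom carr by auto
next
  assume R: ?R
  have "\<rho> g \<in> Units (ring_mat TYPE(complex) n ())" if g: "g \<in> carrier G" for g
  proof -
    have "\<rho> (inv g) * \<rho> g = 1\<^sub>m n" "\<rho> g * \<rho> (inv g) = 1\<^sub>m n"
      using R g by (metis inv_closed l_inv, metis inv_closed r_inv)
    moreover have "\<rho> (inv g) \<in> carrier_mat n n" "\<rho> g \<in> carrier_mat n n" using R g by auto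
    ultimately show ?thesis unfolding Units_def ring_mat_simps by blast
  qed
  then show "representation G n \<rho>"
    using R by (auto simp: representation_def hom_def general_linear_group_def units_of_def ring_mat_simps)
qed

lemma
  assumes "representation G n \<rho>"
  shows representation_carrier: "g \<in> carrier G \<Longrightarrow> \<rho> g \<in> carrier_mat n n"
    and representation_mult: "g \<in> carrier G \<Longrightarrow> h \<in> carrier G \<Longrightarrow> \<rho> (g \<otimes> h) = \<rho> g * \<rho> h"
    and representation_one: "\<rho> \<one> = 1\<^sub>m n"
  using assms by (auto simp: representation_iff)

lemma irreducible_imp_representation: "irreducible_representation G n \<rho> \<Longrightarrow> representation G n \<rho>"
  by (simp add: irreducible_representation_def)

lemma representation_inv:
  assumes "representation G n \<rho>" "g \<in> carrier G"
  shows "\<rho> (inv g) * \<rho> g = 1\<^sub>m n" "\<rho> g * \<rho> (inv g) = 1\<^sub>m n"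
  using assms by (metis inv_closed l_inv representation_mult representation_one,
      metis inv_closed r_inv representation_mult representation_one)

lemma kernel_invariant:
  assumes \<sigma>: "representation G m \<sigma>" and \<rho>: "representation G n \<rho>" and T: "T \<in> carrier_mat n m"
    and comm: "\<And>g. g \<in> carrier G \<Longrightarrow> \<rho> g * T = T * \<sigma> g"
  shows "invariant_subspace G m \<sigma> {v \<in> carrier_vec m. T *\<^sub>v v = 0\<^sub>v n}"
  unfolding invariant_subspace_iff
proof (intro conjI ballI allI)
  fix v w assume "v \<in> {v \<in> carrier_vec m. T *\<^sub>v v = 0\<^sub>v n}" "w \<in> {v \<in> carrier_vec m. T *\<^sub>v v = 0\<^sub>v n}"
  then show "v + w \<in> {v \<in> carrier_vec m. T *\<^sub>v v = 0\<^sub>v n}"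
    using T by (simp add: mult_add_distrib_mat_vec[of _ n m])
next
  fix c v assume "v \<in> {v \<in> carrier_vec m. T *\<^sub>v v = 0\<^sub>v n}"
  then show "c \<cdot>\<^sub>v v \<in> {v \<in> carrier_vec m. T *\<^sub>v v = 0\<^sub>v n}"
    using T by (auto simp: mult_mat_vec[of _ n m] intro!: eq_vecI)
next
  fix g v assume g: "g \<in> carrier G" and "v \<in> {v \<in> carrier_vec m. T *\<^sub>v v = 0\<^sub>v n}"
  then have v: "v \<in> carrier_vec m" "T *\<^sub>v v = 0\<^sub>v n" by auto
  note c = representation_carrier[OF \<sigma> g] representation_carrier[OF \<rho> g]
  have "T *\<^sub>v (\<sigma> g *\<^sub>v v) = (T * \<sigma> g) *\<^sub>v v" using c T v by (simp add: assoc_mult_mat_vec[of _ n m _ m])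
  also have "\<dots> = \<rho> g *\<^sub>v (T *\<^sub>v v)"
    unfolding comm[OF g, symmetric] using c T v by (simp add: assoc_mult_mat_vec[of _ n n _ m])
  also have "\<dots> = 0\<^sub>v n" using c v by auto
  finally show "\<sigma> g *\<^sub>v v \<in> {v \<in> carrier_vec m. T *\<^sub>v v = 0\<^sub>v n}" using c v by simp
qed (use T in auto)

lemma image_invariant:
  assumes \<sigma>: "representation G m \<sigma>" and \<rho>: "representation G n \<rho>" and T: "T \<in> carrier_mat n m"
    and comm: "\<And>g. g \<in> carrier G \<Longrightarrow> \<rho> g * T = T * \<sigma> g"
  shows "invariant_subspace G n \<rho> ((*\<^sub>v) T ` carrier_vec m)"
  unfolding invariant_subspace_iff
proof (intro conjI ballI allI)
  show "(*\<^sub>v) T ` carrier_vec m \<subseteq> carrier_vec n" using T by auto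
  show "0\<^sub>v n \<in> (*\<^sub>v) T ` carrier_vec m"
    using T by (intro image_eqI[of _ _ "0\<^sub>v m"]) auto
next
  fix v w assume "v \<in> (*\<^sub>v) T ` carrier_vec m" "w \<in> (*\<^sub>v) T ` carrier_vec m"
  then obtain x y where "x \<in> carrier_vec m" "y \<in> carrier_vec m" "v = T *\<^sub>v x" "w = T *\<^sub>v y" by auto
  then show "v + w \<in> (*\<^sub>v) T ` carrier_vec m"
    using T by (intro image_eqI[of _ _ "x + y"]) (auto simp: mult_add_distrib_mat_vec[of _ n m])
next
  fix c v assume "v \<in> (*\<^sub>v) T ` carrier_vec m"
  then obtain x where "x \<in> carrier_vec m" "v = T *\<^sub>v x" by auto
  then show "c \<cdot>\<^sub>v v \<in> (*\<^sub>v) T ` carrier_vec m"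
    using T by (intro image_eqI[of _ _ "c \<cdot>\<^sub>v x"]) (auto simp: mult_mat_vec[of _ n m])
next
  fix g v assume g: "g \<in> carrier G" and "v \<in> (*\<^sub>v) T ` carrier_vec m"
  then obtain x where x: "x \<in> carrier_vec m" "v = T *\<^sub>v x" by auto
  note c = representation_carrier[OF \<sigma> g] representation_carrier[OF \<rho> g]
  have "\<rho> g *\<^sub>v v = (\<rho> g * T) *\<^sub>v x" using c T x by (simp add: assoc_mult_mat_vec[of _ n n _ m])
  also have "\<dots> = T *\<^sub>v (\<sigma> g *\<^sub>v x)"
    unfolding comm[OF g] using c T x by (simp add: assoc_mult_mat_vec[of _ n m _ m])
  finally show "\<rho> g *\<^sub>v v \<in> (*\<^sub>v) T ` carrier_vec m"
    using c x by (intro image_eqI[of _ _ "\<sigma> g *\<^sub>v x"]) auto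
qed

text \<open>
  By irreducibility the kernel of a nonzero intertwiner is zero and its image is the whole space, so
  \<open>T\<close> is bijective.
  A right inverse \<open>Y\<close> of \<open>T\<close> is then also a left inverse, and cyclicity of the trace moves one
  representation to the other.
\<close>

lemma schur_intertwiner:
  assumes \<sigma>: "irreducible_representation G m \<sigma>" and \<rho>: "irreducible_representation G n \<rho>"
    and T: "T \<in> carrier_mat n m"
    and comm: "\<And>g. g \<in> carrier G \<Longrightarrow> \<rho> g * T = T * \<sigma> g"
    and nz: "T \<noteq> 0\<^sub>m n m"
  shows "character_of G \<rho> = character_of G \<sigma>"
proof -
  note \<sigma>r = irreducible_imp_representation[OF \<sigma>] and \<rho>r = irreducible_imp_representation[OF \<rho>]
  have zero: "0\<^sub>m n m *\<^sub>v v = 0\<^sub>v n" if "v \<in> carrier_vec m" for v :: "complex vec"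
    using that by (intro eq_vecI) auto
  have ker: "{v \<in> carrier_vec m. T *\<^sub>v v = 0\<^sub>v n} = {0\<^sub>v m}"
  proof -
    have "{v \<in> carrier_vec m. T *\<^sub>v v = 0\<^sub>v n} \<noteq> carrier_vec m"
    proof
      assume eq: "{v \<in> carrier_vec m. T *\<^sub>v v = 0\<^sub>v n} = carrier_vec m"
      have "T = 0\<^sub>m n m"
        by (rule mat_eqI_mult_vec[OF T]) (use eq zero in auto)
      with nz show False by simp
    qed
    then show ?thesis
      using kernel_invariant[OF \<sigma>r \<rho>r T comm] \<sigma> by (auto simp: irreducible_representation_def)
  qed
  have im: "(*\<^sub>v) T ` carrier_vec m = carrier_vec n"
  proof -
    have "(*\<^sub>v) T ` carrier_vec m \<noteq> {0\<^sub>v n}"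
    proof
      assume eq: "(*\<^sub>v) T ` carrier_vec m = {0\<^sub>v n}"
      have "T = 0\<^sub>m n m"
        by (rule mat_eqI_mult_vec[OF T]) (use eq zero in auto)
      with nz show False by simp
    qed
    then show ?thesis
      using image_invariant[OF \<sigma>r \<rho>r T comm] \<rho> by (auto simp: irreducible_representation_def)
  qed
  have "\<exists>y. \<forall>j<n. y j \<in> carrier_vec m \<and> T *\<^sub>v y j = unit_vec n j"
  proof -
    have "\<exists>y. y \<in> carrier_vec m \<and> T *\<^sub>v y = unit_vec n j" for j
      using im unit_vec_carrier[of n j] by (metis imageE)
    then show ?thesis by metis
  qed
  then obtain y where y: "\<And>j. j < n \<Longrightarrow> y j \<in> carrier_vec m" "\<And>j. j < n \<Longrightarrow> T *\<^sub>v y j = unit_vec n j"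
    by blast
  define Y where "Y = mat m n (\<lambda>(i, j). y j $ i)"
  have Y: "Y \<in> carrier_mat m n" by (simp add: Y_def)
  have colY: "col Y j = y j" if "j < n" for j
    using y(1)[OF that] that by (intro eq_vecI) (auto simp: Y_def)
  have TY: "T * Y = 1\<^sub>m n"
  proof (rule eq_matI)
    fix i j assume ij: "i < dim_row (1\<^sub>m n)" "j < dim_col (1\<^sub>m n)"
    have "(T * Y) $$ (i, j) = (T *\<^sub>v col Y j) $ i" using ij T Y by simp
    then show "(T * Y) $$ (i, j) = 1\<^sub>m n $$ (i, j)" using ij by (simp add: colY y)
  qed (use T Y in auto)
  have YT: "Y * T = 1\<^sub>m m"
  proof (rule mat_eqI_mult_vec[of _ m m])
    fix v :: "complex vec" assume v: "v \<in> carrier_vec m"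
    define d where "d = Y *\<^sub>v (T *\<^sub>v v) - v"
    have "T *\<^sub>v d = T *\<^sub>v (Y *\<^sub>v (T *\<^sub>v v)) - T *\<^sub>v v"
      unfolding d_def using v T Y by (intro mult_minus_distrib_mat_vec[of _ n m]) auto
    also have "T *\<^sub>v (Y *\<^sub>v (T *\<^sub>v v)) = (T * Y) *\<^sub>v (T *\<^sub>v v)"
      using v T Y by (intro assoc_mult_mat_vec[symmetric, of _ n m _ n]) auto
    also have "\<dots> - T *\<^sub>v v = 0\<^sub>v n" using TY T v by auto
    finally have "T *\<^sub>v d = 0\<^sub>v n" .
    moreover have "d \<in> carrier_vec m" unfolding d_def using T Y v by auto
    ultimately have "d = 0\<^sub>v m" using ker by blast
    then have "d + v = v" using v by simp
    then have "Y *\<^sub>v (T *\<^sub>v v) = v"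
      unfolding d_def using v Y T by (subst (asm) diff_add_cancel_vec) auto
    then show "(Y * T) *\<^sub>v v = 1\<^sub>m m *\<^sub>v v" using v T Y by (simp add: assoc_mult_mat_vec[of _ m n _ m])
  qed (use T Y in auto)
  have "mat_trace (\<rho> g) = mat_trace (\<sigma> g)" if g: "g \<in> carrier G" for g
  proof -
    note c = representation_carrier[OF \<sigma>r g] representation_carrier[OF \<rho>r g]
    have "\<rho> g = \<rho> g * (T * Y)" using TY c by simp
    also have "\<dots> = T * \<sigma> g * Y"
      using c T Y comm[OF g] by (simp flip: assoc_mult_mat[of _ n n _ m])
    finally have "mat_trace (\<rho> g) = mat_trace (T * \<sigma> g * Y)" by simp
    also have "\<dots> = mat_trace (Y * (T * \<sigma> g))"
      using c T Y by (intro mat_trace_mult_comm[of _ n m]) auto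
    also have "Y * (T * \<sigma> g) = Y * T * \<sigma> g"
      using c T Y by (intro assoc_mult_mat[symmetric, of _ m n _ m]) auto
    also have "\<dots> = \<sigma> g" using c YT by simp
    finally show ?thesis .
  qed
  then show ?thesis by (auto simp: character_of_def)
qed

text \<open>
  An eigenspace of \<open>T\<close> is a nonzero invariant subspace, hence everything.
\<close>

lemma schur_scalar:
  assumes \<rho>: "irreducible_representation G n \<rho>" and T: "T \<in> carrier_mat n n"
    and comm: "\<And>g. g \<in> carrier G \<Longrightarrow> \<rho> g * T = T * \<rho> g"
  obtains c where "T = c \<cdot>\<^sub>m 1\<^sub>m n"
proof -
  note \<rho>r = irreducible_imp_representation[OF \<rho>]
  have "n > 0" using \<rho> by (simp add: irreducible_representation_def)
  from spectrum_non_empty[OF T this] obtain c where "eigenvalue T c"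
    by (auto simp: spectrum_def)
  then obtain v where v: "v \<in> carrier_vec n" "v \<noteq> 0\<^sub>v n" "T *\<^sub>v v = c \<cdot>\<^sub>v v"
    using T by (auto simp: eigenvalue_def eigenvector_def)
  have scalar: "(c \<cdot>\<^sub>m 1\<^sub>m n) *\<^sub>v w = c \<cdot>\<^sub>v w" if "w \<in> carrier_vec n" for w
    using that by (intro eq_vecI) auto
  define S where "S = T - c \<cdot>\<^sub>m 1\<^sub>m n"
  have S: "S \<in> carrier_mat n n" unfolding S_def by (intro minus_carrier_mat) simp
  have Sv: "S *\<^sub>v w = T *\<^sub>v w - c \<cdot>\<^sub>v w" if "w \<in> carrier_vec n" for w
  proof -
    have "S *\<^sub>v w = T *\<^sub>v w - (c \<cdot>\<^sub>m 1\<^sub>m n) *\<^sub>v w"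
      unfolding S_def using that T by (intro minus_mult_distrib_mat_vec[of _ n n]) auto
    also have "(c \<cdot>\<^sub>m 1\<^sub>m n) *\<^sub>v w = c \<cdot>\<^sub>v w"
      using that by (rule scalar)
    finally show ?thesis .
  qed
  have "\<rho> g * S = S * \<rho> g" if g: "g \<in> carrier G" for g
  proof -
    note c = representation_carrier[OF \<rho>r g]
    have "\<rho> g * S = \<rho> g * T - \<rho> g * (c \<cdot>\<^sub>m 1\<^sub>m n)"
      unfolding S_def using c T by (intro mult_minus_distrib_mat[of _ n n]) auto
    also have "\<rho> g * (c \<cdot>\<^sub>m 1\<^sub>m n) = (c \<cdot>\<^sub>m 1\<^sub>m n) * \<rho> g"
      using c by (simp add: mult_smult_distrib[of _ n n _ n] mult_smult_assoc_mat[of _ n n _ n])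
    also have "\<rho> g * T - \<dots> = S * \<rho> g"
      unfolding S_def comm[OF g] using c T by (intro minus_mult_distrib_mat[symmetric, of _ n n]) auto
    finally show ?thesis .
  qed
  from kernel_invariant[OF \<rho>r \<rho>r S this] \<rho>
  have "{w \<in> carrier_vec n. S *\<^sub>v w = 0\<^sub>v n} = {0\<^sub>v n} \<or> {w \<in> carrier_vec n. S *\<^sub>v w = 0\<^sub>v n} = carrier_vec n"
    by (auto simp: irreducible_representation_def)
  moreover have "v \<in> {w \<in> carrier_vec n. S *\<^sub>v w = 0\<^sub>v n}" using v Sv[of v] by auto
  ultimately have all: "S *\<^sub>v w = 0\<^sub>v n" if "w \<in> carrier_vec n" for w
    using that v by blast
  have "T = c \<cdot>\<^sub>m 1\<^sub>m n"
  proof (rule mat_eqI_mult_vec[OF T])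
    fix w :: "complex vec" assume w: "w \<in> carrier_vec n"
    have "T *\<^sub>v w - c \<cdot>\<^sub>v w = 0\<^sub>v n" using all[OF w] Sv[OF w] by simp
    then have "T *\<^sub>v w - c \<cdot>\<^sub>v w + c \<cdot>\<^sub>v w = c \<cdot>\<^sub>v w" using w by simp
    then have "T *\<^sub>v w = c \<cdot>\<^sub>v w" using w T by (subst (asm) diff_add_cancel_vec) auto
    also have "\<dots> = (c \<cdot>\<^sub>m 1\<^sub>m n) *\<^sub>v w"
      using scalar[OF w] by simp
    finally show "T *\<^sub>v w = (c \<cdot>\<^sub>m 1\<^sub>m n) *\<^sub>v w" .
  qed simp
  then show ?thesis by (rule that)
qed

section \<open>Orthogonality of irreducible characters\<close>

lemma bij_betw_mult_left: "x \<in> carrier G \<Longrightarrow> bij_betw (\<lambda>g. x \<otimes> g) (carrier G) (carrier G)"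
  by (rule bij_betwI[of _ _ _ "\<lambda>g. inv x \<otimes> g"]) (auto simp flip: m_assoc)

lemma bij_betw_mult_right: "x \<in> carrier G \<Longrightarrow> bij_betw (\<lambda>g. g \<otimes> x) (carrier G) (carrier G)"
  by (rule bij_betwI[of _ _ _ "\<lambda>g. g \<otimes> inv x"]) (auto simp: m_assoc)

lemma bij_betw_conjugation:
  "x \<in> carrier G \<Longrightarrow> bij_betw (\<lambda>g. x \<otimes> g \<otimes> inv x) (carrier G) (carrier G)"
  using bij_betw_trans[OF bij_betw_mult_left bij_betw_mult_right[OF inv_closed], of x x]
  by (simp add: comp_def)

text \<open>
  Averaging any matrix over the group produces an intertwiner, by the substitution \<open>g \<mapsto> x g\<close>.
\<close>

lemma average_intertwines:
  assumes \<rho>: "representation G n \<rho>" and \<sigma>: "representation G m \<sigma>"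
    and X: "X \<in> carrier_mat n m" and x: "x \<in> carrier G"
  defines "T \<equiv> mat_sum n m (\<lambda>g. \<rho> g * X * \<sigma> (inv g)) (carrier G)"
  shows "\<rho> x * T = T * \<sigma> x"
proof -
  note c = representation_carrier[OF \<rho>] representation_carrier[OF \<sigma>]
  have F: "\<rho> g * X * \<sigma> (inv g) \<in> carrier_mat n m" if "g \<in> carrier G" for g
    using c[OF that] c[OF inv_closed[OF that]] X by auto
  have "T * \<sigma> x = mat_sum n m (\<lambda>g. \<rho> g * X * \<sigma> (inv g) * \<sigma> x) (carrier G)"
    unfolding T_def using c(2)[OF x] F by (rule mat_sum_mult)
  also have "\<dots> = mat_sum n m (\<lambda>g. \<rho> (x \<otimes> g) * X * \<sigma> (inv (x \<otimes> g)) * \<sigma> x) (carrier G)"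
    by (rule mat_sum_reindex[OF bij_betw_mult_left[OF x]])
  also have "\<dots> = mat_sum n m (\<lambda>g. \<rho> x * (\<rho> g * X * \<sigma> (inv g))) (carrier G)"
  proof (rule mat_sum_cong)
    fix g assume g: "g \<in> carrier G"
    note cg = c[OF g] c[OF x] c[OF inv_closed[OF g]] c[OF inv_closed[OF m_closed[OF x g]]]
    have "\<sigma> (inv (x \<otimes> g)) * \<sigma> x = \<sigma> (inv (x \<otimes> g) \<otimes> x)"
      using x g by (simp add: representation_mult[OF \<sigma>])
    also have "inv (x \<otimes> g) \<otimes> x = inv g" using x g by (simp add: inv_mult_group m_assoc)
    finally have inv: "\<sigma> (inv (x \<otimes> g)) * \<sigma> x = \<sigma> (inv g)" .
    have "\<rho> (x \<otimes> g) * X * \<sigma> (inv (x \<otimes> g)) * \<sigma> x = \<rho> (x \<otimes> g) * X * (\<sigma> (inv (x \<otimes> g)) * \<sigma> x)"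
      using cg X c[OF m_closed[OF x g]] by (intro assoc_mult_mat[of _ n m _ m _ m]) auto
    also have "\<dots> = \<rho> x * \<rho> g * X * \<sigma> (inv g)"
      unfolding inv using x g by (simp add: representation_mult[OF \<rho>])
    also have "\<dots> = \<rho> x * (\<rho> g * X * \<sigma> (inv g))"
      using cg X by (simp add: assoc_mult_mat[of _ n n _ m _ m] assoc_mult_mat[of _ n n _ n _ m]
          assoc_mult_mat[of _ n m _ m _ m])
    finally show "\<rho> (x \<otimes> g) * X * \<sigma> (inv (x \<otimes> g)) * \<sigma> x = \<rho> x * (\<rho> g * X * \<sigma> (inv g))" .
  qed
  also have "\<dots> = \<rho> x * T"
    unfolding T_def using c(1)[OF x] F by (rule mult_mat_sum[symmetric])
  finally show ?thesis by simp
qed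

text \<open>
  The unnormalized inner product of two characters, expressed by averaged matrix units, to which
  Schur's lemma applies.
\<close>

lemma sum_mat_trace_mult:
  assumes \<rho>: "representation G n \<rho>" and \<sigma>: "representation G m \<sigma>"
  shows "(\<Sum>g\<in>carrier G. mat_trace (\<rho> g) * mat_trace (\<sigma> (inv g))) =
    (\<Sum>i<n. \<Sum>j<m. mat_sum n m (\<lambda>g. \<rho> g * matrix_unit n m i j * \<sigma> (inv g)) (carrier G) $$ (i, j))"
proof -
  note c = representation_carrier[OF \<rho>] representation_carrier[OF \<sigma>]
  have "(\<Sum>g\<in>carrier G. mat_trace (\<rho> g) * mat_trace (\<sigma> (inv g))) =
      (\<Sum>g\<in>carrier G. \<Sum>i<n. \<Sum>j<m. (\<rho> g * matrix_unit n m i j * \<sigma> (inv g)) $$ (i, j))"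
  proof (rule sum.cong[OF refl])
    fix g assume g: "g \<in> carrier G"
    have "mat_trace (\<rho> g) * mat_trace (\<sigma> (inv g)) = (\<Sum>i<n. \<Sum>j<m. \<rho> g $$ (i, i) * \<sigma> (inv g) $$ (j, j))"
      using c(1)[OF g] c(2)[OF inv_closed[OF g]] by (simp add: mat_trace_eq_sum[of _ n n] mat_trace_eq_sum[of _ m m] sum_product)
    also have "\<dots> = (\<Sum>i<n. \<Sum>j<m. (\<rho> g * matrix_unit n m i j * \<sigma> (inv g)) $$ (i, j))"
      using mult_matrix_unit_mult[OF c(1)[OF g] c(2)[OF inv_closed[OF g]]]
      by (intro sum.cong refl) simp
    finally show "mat_trace (\<rho> g) * mat_trace (\<sigma> (inv g)) = \<dots>" .
  qed
  also have "\<dots> = (\<Sum>i<n. \<Sum>j<m. \<Sum>g\<in>carrier G. (\<rho> g * matrix_unit n m i j * \<sigma> (inv g)) $$ (i, j))"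
    by (subst sum.swap, intro sum.cong refl, subst sum.swap, simp)
  also have "\<dots> = (\<Sum>i<n. \<Sum>j<m. mat_sum n m (\<lambda>g. \<rho> g * matrix_unit n m i j * \<sigma> (inv g)) (carrier G) $$ (i, j))"
    by (intro sum.cong refl) simp
  finally show ?thesis .
qed

lemma orthogonality_different:
  assumes \<rho>: "irreducible_representation G n \<rho>" and \<sigma>: "irreducible_representation G m \<sigma>"
    and ne: "character_of G \<rho> \<noteq> character_of G \<sigma>"
  shows "(\<Sum>g\<in>carrier G. mat_trace (\<rho> g) * mat_trace (\<sigma> (inv g))) = 0"
proof -
  note \<rho>r = irreducible_imp_representation[OF \<rho>] and \<sigma>r = irreducible_imp_representation[OF \<sigma>]
  have "mat_sum n m (\<lambda>g. \<rho> g * matrix_unit n m i j * \<sigma> (inv g)) (carrier G) = 0\<^sub>m n m" for i j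
    using schur_intertwiner[OF \<sigma> \<rho> mat_sum_carrier average_intertwines[OF \<rho>r \<sigma>r matrix_unit_carrier]] ne
    by blast
  then show ?thesis by (simp add: sum_mat_trace_mult[OF \<rho>r \<sigma>r])
qed

text \<open>
  The sum of all conjugates of \<open>E\<^sub>i\<^sub>j\<close> is a scalar matrix by Schur's lemma, and its trace is that of
  \<open>|G| E\<^sub>i\<^sub>j\<close>. This determines the scalar as \<open>|G| / n\<close> for \<open>i = j\<close> and as 0 otherwise.
\<close>

lemma orthogonality_same:
  assumes \<rho>: "irreducible_representation G n \<rho>"
  shows "(\<Sum>g\<in>carrier G. mat_trace (\<rho> g) * mat_trace (\<rho> (inv g))) = of_nat (card (carrier G))"
proof -
  note \<rho>r = irreducible_imp_representation[OF \<rho>]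
  note c = representation_carrier[OF \<rho>r]
  have n: "n > 0" using \<rho> by (simp add: irreducible_representation_def)
  have coeff: "mat_sum n n (\<lambda>g. \<rho> g * matrix_unit n n i j * \<rho> (inv g)) (carrier G) $$ (i, j) =
      (if i = j then of_nat (card (carrier G)) / of_nat n else 0)" if ij: "i < n" "j < n" for i j
  proof -
    define T where "T = mat_sum n n (\<lambda>g. \<rho> g * matrix_unit n n i j * \<rho> (inv g)) (carrier G)"
    obtain t where t: "T = t \<cdot>\<^sub>m 1\<^sub>m n"
      using schur_scalar[OF \<rho> mat_sum_carrier average_intertwines[OF \<rho>r \<rho>r matrix_unit_carrier]]
      unfolding T_def by blast
    have tr: "mat_trace (\<rho> g * matrix_unit n n i j * \<rho> (inv g)) = (if i = j then 1 else 0)"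
      if g: "g \<in> carrier G" for g
      using c[OF g] c[OF inv_closed[OF g]] representation_inv[OF \<rho>r g]
      by (subst mat_trace_conjugate[of _ n]) (auto simp: mat_trace_matrix_unit[OF ij(1)])
    have "t * of_nat n = mat_trace T" by (simp add: t mat_trace_smult_one)
    also have "\<dots> = (\<Sum>g\<in>carrier G. mat_trace (\<rho> g * matrix_unit n n i j * \<rho> (inv g)))"
      unfolding T_def using c by (intro mat_trace_mat_sum) (metis inv_closed mult_carrier_mat matrix_unit_carrier)
    also have "\<dots> = (if i = j then of_nat (card (carrier G)) else 0)"
      by (simp add: tr)
    finally have "t = (if i = j then of_nat (card (carrier G)) / of_nat n else 0)"
      using n by (auto simp: field_simps)
    then have "T $$ (i, j) = (if i = j then of_nat (card (carrier G)) / of_nat n else 0)"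
      using ij by (simp add: t)
    then show ?thesis by (simp only: T_def)
  qed
  have "(\<Sum>g\<in>carrier G. mat_trace (\<rho> g) * mat_trace (\<rho> (inv g))) =
      (\<Sum>i<n. \<Sum>j<n. if i = j then of_nat (card (carrier G)) / of_nat n else 0)"
    unfolding sum_mat_trace_mult[OF \<rho>r \<rho>r] by (intro sum.cong refl) (use coeff in auto)
  also have "\<dots> = of_nat (card (carrier G))"
    using n by simp
  finally show ?thesis .
qed

theorem first_orthogonality:
  assumes "\<chi> \<in> Irr G" "\<psi> \<in> Irr G"
  shows "(\<Sum>g\<in>carrier G. \<chi> g * \<psi> (inv g)) = (if \<chi> = \<psi> then of_nat (card (carrier G)) else 0)"
proof -
  obtain n \<rho> m \<sigma> where \<rho>: "irreducible_representation G n \<rho>" "\<chi> = character_of G \<rho>"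
    and \<sigma>: "irreducible_representation G m \<sigma>" "\<psi> = character_of G \<sigma>"
    using assms by (auto simp: Irr_def)
  show ?thesis
  proof (cases "\<chi> = \<psi>")
    case True
    have "(\<Sum>g\<in>carrier G. \<chi> g * \<psi> (inv g)) = (\<Sum>g\<in>carrier G. mat_trace (\<rho> g) * mat_trace (\<rho> (inv g)))"
      unfolding True[symmetric] \<rho>(2) by (intro sum.cong) (auto simp: character_of_def)
    with orthogonality_same[OF \<rho>(1)] True show ?thesis by simp
  next
    case False
    have "(\<Sum>g\<in>carrier G. \<chi> g * \<psi> (inv g)) = (\<Sum>g\<in>carrier G. mat_trace (\<rho> g) * mat_trace (\<sigma> (inv g)))"
      unfolding \<rho>(2) \<sigma>(2) by (intro sum.cong) (auto simp: character_of_def)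
    with orthogonality_different[OF \<rho>(1) \<sigma>(1)] False \<rho>(2) \<sigma>(2) show ?thesis by simp
  qed
qed

section \<open>Completeness of irreducible characters\<close>

text \<open>
  In coordinates adapted to an invariant subspace all representing matrices are block upper
  triangular. The two diagonal blocks are representations of smaller degree, on the subspace and on
  the quotient by it.
\<close>

lemma representation_block_split:
  assumes \<rho>: "representation G n \<rho>" and W: "invariant_subspace G n \<rho> W"
    and proper: "W \<noteq> {0\<^sub>v n}" "W \<noteq> carrier_vec n"
  obtains k A D where "0 < k" "k < n" "representation G k A" "representation G (n - k) D"
    "\<And>g. g \<in> carrier G \<Longrightarrow> mat_trace (\<rho> g) = mat_trace (A g) + mat_trace (D g)"
proof -
  note c = representation_carrier[OF \<rho>]
  obtain k Q where k: "k \<le> n" and Q: "Q \<in> carrier_mat n n" "det Q \<noteq> 0"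
    and Weq: "W = {v \<in> carrier_vec n. \<forall>i\<in>{k..<n}. (Q *\<^sub>v v) $ i = 0}"
    using W unfolding invariant_subspace_iff by (elim conjE) (rule adapted_coordinates[of W n], auto)
  obtain P where P: "P \<in> carrier_mat n n" "P * Q = 1\<^sub>m n" "Q * P = 1\<^sub>m n"
    using mat_inverse_exists[OF Q] .
  have "k \<noteq> n" using proper(2) by (auto simp: Weq)
  with k have kn: "k < n" by simp
  have "k \<noteq> 0"
  proof
    assume "k = 0"
    have "v = 0\<^sub>v n" if "v \<in> W" for v
    proof -
      have v: "v \<in> carrier_vec n" "\<forall>i\<in>{0..<n}. (Q *\<^sub>v v) $ i = 0" using that \<open>k = 0\<close> by (auto simp: Weq)
      have "Q *\<^sub>v v = 0\<^sub>v n" by (rule eq_vecI) (use v Q in auto)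
      then show ?thesis using v(1) Q det_0_iff_vec_prod_zero_field[OF Q(1)] by blast
    qed
    moreover have "0\<^sub>v n \<in> W" using W by (simp add: invariant_subspace_iff)
    ultimately show False using proper(1) by blast
  qed
  then have k0: "0 < k" by simp
  define B where "B g = Q * \<rho> g * P" for g
  have B: "B g \<in> carrier_mat n n" if "g \<in> carrier G" for g
    using c[OF that] P Q by (auto simp: B_def)
  have B_mult: "B (g \<otimes> h) = B g * B h" if gh: "g \<in> carrier G" "h \<in> carrier G" for g h
  proof -
    note cc = c[OF gh(1)] c[OF gh(2)]
    have "B g * B h = Q * \<rho> g * (P * (Q * \<rho> h * P))"
      unfolding B_def using cc P Q by (intro assoc_mult_mat[of _ n n _ n _ n]) auto
    also have "P * (Q * \<rho> h * P) = P * Q * (\<rho> h * P)"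
      using cc P(1) Q(1) by (simp add: assoc_mult_mat[of _ n n _ n _ n])
    also have "\<dots> = \<rho> h * P" using cc P by simp
    also have "Q * \<rho> g * (\<rho> h * P) = Q * (\<rho> g * \<rho> h) * P"
      using cc P(1) Q(1) by (simp add: assoc_mult_mat[of _ n n _ n _ n])
    finally show ?thesis using representation_mult[OF \<rho> gh] by (simp add: B_def)
  qed
  have B_one: "B \<one> = 1\<^sub>m n"
    using P Q by (simp add: B_def representation_one[OF \<rho>])
  \<comment> \<open>Column \<open>j\<close> of \<open>B g\<close> is the coordinate vector of the image of a basis vector of \<open>W\<close>.\<close>
  have low: "B g $$ (i, j) = 0" if g: "g \<in> carrier G" and ij: "k \<le> i" "i < n" "j < k" for g i j
  proof -
    have j: "j < n" using ij kn by simp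
    have Pj: "P *\<^sub>v unit_vec n j \<in> carrier_vec n" using P by auto
    have "Q *\<^sub>v (P *\<^sub>v unit_vec n j) = (Q * P) *\<^sub>v unit_vec n j"
      using P Q by (intro assoc_mult_mat_vec[symmetric, of _ n n _ n]) auto
    then have "P *\<^sub>v unit_vec n j \<in> W"
      using Pj ij(3) P j by (auto simp: Weq)
    then have "\<rho> g *\<^sub>v (P *\<^sub>v unit_vec n j) \<in> W"
      using W g by (simp add: invariant_subspace_iff)
    then have "(Q *\<^sub>v (\<rho> g *\<^sub>v (P *\<^sub>v unit_vec n j))) $ i = 0"
      using ij by (auto simp: Weq)
    also have "Q *\<^sub>v (\<rho> g *\<^sub>v (P *\<^sub>v unit_vec n j)) = B g *\<^sub>v unit_vec n j"
      unfolding B_def using P Q c[OF g]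
      by (simp add: assoc_mult_mat_vec[of _ n n _ n] assoc_mult_mat[of _ n n _ n _ n])
    also have "\<dots> $ i = B g $$ (i, j)" using B[OF g] ij j by simp
    finally show ?thesis .
  qed
  define A where "A g = mat k k (\<lambda>(i, j). B g $$ (i, j))" for g
  define D where "D g = mat (n - k) (n - k) (\<lambda>(i, j). B g $$ (k + i, k + j))" for g
  have split: "(\<Sum>l<n. f l) = (\<Sum>l<k. f l) + (\<Sum>l<n - k. f (k + l))" for f :: "nat \<Rightarrow> complex"
    using sum.atLeastLessThan_concat[of 0 k n f] sum.shift_bounds_nat_ivl[of f 0 k "n - k"] k
    by (simp add: atLeast0LessThan add.commute)
  show ?thesis
  proof (rule that[OF k0 kn])
    show "representation G k A"
      unfolding representation_iff
    proof (intro conjI ballI)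
      fix g h assume gh: "g \<in> carrier G" "h \<in> carrier G"
      show "A (g \<otimes> h) = A g * A h"
      proof (rule eq_matI)
        fix i j assume "i < dim_row (A g * A h)" "j < dim_col (A g * A h)"
        then have ij: "i < k" "j < k" by (auto simp: A_def)
        then have "A (g \<otimes> h) $$ (i, j) = (\<Sum>l<n. B g $$ (i, l) * B h $$ (l, j))"
          using kn unfolding A_def B_mult[OF gh] by (simp add: index_mult_mat_sum[OF B[OF gh(1)] B[OF gh(2)]] del: index_mult_mat(1))
        also have "\<dots> = (\<Sum>l<k. B g $$ (i, l) * B h $$ (l, j))"
          unfolding split using low[OF gh(2) _ _ ij(2)] by (simp add: less_diff_conv add.commute)
        also have "\<dots> = (A g * A h) $$ (i, j)"
          using ij by (subst index_mult_mat_sum[of _ k k _ k]) (auto simp: A_def)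
        finally show "A (g \<otimes> h) $$ (i, j) = (A g * A h) $$ (i, j)" .
      qed (auto simp: A_def)
    next
      show "A \<one> = 1\<^sub>m k" unfolding A_def B_one using kn by (intro eq_matI) auto
    qed (auto simp: A_def)
    show "representation G (n - k) D"
      unfolding representation_iff
    proof (intro conjI ballI)
      fix g h assume gh: "g \<in> carrier G" "h \<in> carrier G"
      show "D (g \<otimes> h) = D g * D h"
      proof (rule eq_matI)
        fix i j assume "i < dim_row (D g * D h)" "j < dim_col (D g * D h)"
        then have ij: "i < n - k" "j < n - k" "k + i < n" "k + j < n" by (auto simp: D_def)
        then have "D (g \<otimes> h) $$ (i, j) = (\<Sum>l<n. B g $$ (k + i, l) * B h $$ (l, k + j))"
          unfolding D_def B_mult[OF gh] by (simp add: index_mult_mat_sum[OF B[OF gh(1)] B[OF gh(2)]] del: index_mult_mat(1))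
        also have "\<dots> = (\<Sum>l<n - k. B g $$ (k + i, k + l) * B h $$ (k + l, k + j))"
          unfolding split using low[OF gh(1) le_add1 ij(3)] by simp
        also have "\<dots> = (D g * D h) $$ (i, j)"
          using ij by (subst index_mult_mat_sum[of _ "n - k" "n - k" _ "n - k"]) (auto simp: D_def)
        finally show "D (g \<otimes> h) $$ (i, j) = (D g * D h) $$ (i, j)" .
      qed (auto simp: D_def)
    next
      show "D \<one> = 1\<^sub>m (n - k)" unfolding D_def B_one using kn by (intro eq_matI) auto
    qed (auto simp: D_def)
    fix g assume g: "g \<in> carrier G"
    have "mat_trace (\<rho> g) = mat_trace (B g)"
      unfolding B_def using P Q c[OF g] by (subst mat_trace_conjugate[of _ n]) auto
    also have "\<dots> = (\<Sum>l<n. B g $$ (l, l))" using B[OF g] by (rule mat_trace_eq_sum)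
    also have "\<dots> = mat_trace (A g) + mat_trace (D g)"
      unfolding split by (simp add: mat_trace_def A_def D_def)
    finally show "mat_trace (\<rho> g) = mat_trace (A g) + mat_trace (D g)" .
  qed
qed

text \<open>
  By induction on the degree every trace of a representation is a sum of irreducible characters.
\<close>

lemma orthogonal_to_Irr_imp_orthogonal_to_traces:
  assumes orth: "\<And>\<psi>. \<psi> \<in> Irr G \<Longrightarrow> (\<Sum>g\<in>carrier G. h g * \<psi> g) = 0"
    and "representation G n \<rho>"
  shows "(\<Sum>g\<in>carrier G. h g * mat_trace (\<rho> g)) = 0"
  using assms(2)
proof (induction n arbitrary: \<rho> rule: less_induct)
  case (less n)
  show ?case
  proof (cases "n = 0")
    case True
    have "mat_trace (\<rho> g) = 0" if "g \<in> carrier G" for g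
      using representation_carrier[OF less.prems that] True by (simp add: mat_trace_def)
    then show ?thesis by simp
  next
    case False
    show ?thesis
    proof (cases "irreducible_representation G n \<rho>")
      case True
      then have "character_of G \<rho> \<in> Irr G" by (auto simp: Irr_def)
      from orth[OF this] show ?thesis by (simp add: character_of_def)
    next
      case False
      then obtain W where "invariant_subspace G n \<rho> W" "W \<noteq> {0\<^sub>v n}" "W \<noteq> carrier_vec n"
        using \<open>n \<noteq> 0\<close> less.prems by (auto simp: irreducible_representation_def)
      then obtain k A D where k: "0 < k" "k < n" and AD: "representation G k A" "representation G (n - k) D"
        and tr: "\<And>g. g \<in> carrier G \<Longrightarrow> mat_trace (\<rho> g) = mat_trace (A g) + mat_trace (D g)"
        using representation_block_split[OF less.prems] by metis
      have "(\<Sum>g\<in>carrier G. h g * mat_trace (A g)) = 0" "(\<Sum>g\<in>carrier G. h g * mat_trace (D g)) = 0"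
        using k AD by (auto intro: less.IH[of k A] less.IH[of "n - k" D])
      then show ?thesis by (simp add: tr distrib_left sum.distrib)
    qed
  qed
qed

lemma regular_representation:
  obtains R where "representation G (card (carrier G)) R"
    "\<And>g. g \<in> carrier G \<Longrightarrow> mat_trace (R g) = (if g = \<one> then of_nat (card (carrier G)) else 0)"
proof -
  define N where "N = card (carrier G)"
  obtain e where "bij_betw e {0..<N} (carrier G)"
    using ex_bij_betw_nat_finite[OF finite_carrier] by (auto simp: N_def)
  then have e: "bij_betw e {..<N} (carrier G)" by (simp add: atLeast0LessThan)
  have e_in: "e i \<in> carrier G" if "i < N" for i using e that by (auto simp: bij_betw_def)
  have e_inj: "e i = e j \<longleftrightarrow> i = j" if "i < N" "j < N" for i j
    using e that by (auto simp: bij_betw_def inj_on_def)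
  define R where "R g = mat N N (\<lambda>(i, j). if e i = g \<otimes> e j then 1 else 0 :: complex)" for g
  have R: "R g \<in> carrier_mat N N" for g by (simp add: R_def)
  show ?thesis
  proof (rule that[of R])
    show "representation G (card (carrier G)) R"
      unfolding representation_iff N_def[symmetric]
    proof (intro conjI ballI)
      fix g h assume gh: "g \<in> carrier G" "h \<in> carrier G"
      show "R (g \<otimes> h) = R g * R h"
      proof (rule eq_matI)
        fix i j assume "i < dim_row (R g * R h)" "j < dim_col (R g * R h)"
        then have ij: "i < N" "j < N" by (auto simp: R_def)
        have "(R g * R h) $$ (i, j) = (\<Sum>l<N. (if e i = g \<otimes> e l then 1 else 0) * (if e l = h \<otimes> e j then 1 else 0))"
          using ij by (subst index_mult_mat_sum[OF R R]) (auto simp: R_def)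
        also have "\<dots> = (\<Sum>y\<in>carrier G. (if e i = g \<otimes> y then 1 else 0) * (if y = h \<otimes> e j then 1 else 0))"
          by (rule sum.reindex_bij_betw[OF e])
        also have "\<dots> = (\<Sum>y\<in>carrier G. if y = h \<otimes> e j then (if e i = g \<otimes> y then 1 else 0) else 0)"
          by (intro sum.cong) auto
        also have "\<dots> = (if e i = g \<otimes> (h \<otimes> e j) then 1 else 0)"
          using finite_carrier gh e_in[OF ij(2)] by (simp add: sum.delta)
        also have "\<dots> = R (g \<otimes> h) $$ (i, j)"
          using ij gh e_in[OF ij(2)] by (simp add: R_def m_assoc)
        finally show "R (g \<otimes> h) $$ (i, j) = (R g * R h) $$ (i, j)" by simp
      qed (auto simp: R_def)
    next
      show "R \<one> = 1\<^sub>m N" by (rule eq_matI) (auto simp: R_def e_in e_inj)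
    qed (auto simp: R_def)
    fix g assume g: "g \<in> carrier G"
    have "e i = g \<otimes> e i \<longleftrightarrow> g = \<one>" if "i < N" for i
      using r_cancel_one'[OF e_in[OF that] g] by simp
    then show "mat_trace (R g) = (if g = \<one> then of_nat (card (carrier G)) else 0)"
      by (simp add: mat_trace_def R_def N_def)
  qed
qed

text \<open>
  The trace of the regular representation is \<open>|G|\<close> times the indicator of the neutral element, so
  pairing with it evaluates \<open>h\<close> at 1.
\<close>

lemma orthogonal_to_Irr_imp_zero_at_one:
  assumes "\<And>\<psi>. \<psi> \<in> Irr G \<Longrightarrow> (\<Sum>g\<in>carrier G. h g * \<psi> g) = 0"
  shows "h \<one> = 0"
proof -
  obtain R where R: "representation G (card (carrier G)) R"
    and tr: "\<And>g. g \<in> carrier G \<Longrightarrow> mat_trace (R g) = (if g = \<one> then of_nat (card (carrier G)) else 0)"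
    using regular_representation by blast
  have "0 = (\<Sum>g\<in>carrier G. h g * mat_trace (R g))"
    using orthogonal_to_Irr_imp_orthogonal_to_traces[OF assms R] by simp
  also have "\<dots> = (\<Sum>g\<in>carrier G. if g = \<one> then h g * of_nat (card (carrier G)) else 0)"
    by (intro sum.cong) (auto simp: tr)
  also have "\<dots> = h \<one> * of_nat (card (carrier G))"
    using finite_carrier by (simp add: sum.delta)
  finally show ?thesis using finite_carrier by (auto simp: card_eq_0_iff)
qed

text \<open>
  For a class function \<open>h\<close> the matrix \<open>\<Sum>\<^sub>g h(g) \<rho>(g)\<close> commutes with the irreducible representation
  \<open>\<rho>\<close>, so it is a scalar, and its trace is the given inner product 0. Hence this matrix vanishes.
  Multiplying it by \<open>\<rho>(x\<^sup>-\<^sup>1)\<close> shows that the translate \<open>g \<mapsto> h(g x)\<close>, which need not be a class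
  function, is also orthogonal to all irreducible characters, so its value at 1 is 0.
\<close>

theorem class_function_orthogonal_to_Irr_eq_zero:
  assumes conj_invariant: "\<And>x g. x \<in> carrier G \<Longrightarrow> g \<in> carrier G \<Longrightarrow> h (x \<otimes> g \<otimes> inv x) = h g"
    and orth: "\<And>\<psi>. \<psi> \<in> Irr G \<Longrightarrow> (\<Sum>g\<in>carrier G. h g * \<psi> g) = 0"
    and x: "x \<in> carrier G"
  shows "h x = 0"
proof -
  have "(\<Sum>g\<in>carrier G. h (g \<otimes> x) * \<psi> g) = 0" if "\<psi> \<in> Irr G" for \<psi>
  proof -
    obtain n \<rho> where \<rho>: "irreducible_representation G n \<rho>" and \<psi>: "\<psi> = character_of G \<rho>"
      using \<open>\<psi> \<in> Irr G\<close> by (auto simp: Irr_def)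
    note \<rho>r = irreducible_imp_representation[OF \<rho>]
    note c = representation_carrier[OF \<rho>r]
    have n: "n > 0" using \<rho> by (simp add: irreducible_representation_def)
    define T where "T = mat_sum n n (\<lambda>g. h g \<cdot>\<^sub>m \<rho> g) (carrier G)"
    have T: "T \<in> carrier_mat n n" by (simp add: T_def)
    have T_right: "T * \<rho> y = mat_sum n n (\<lambda>g. h g \<cdot>\<^sub>m \<rho> (g \<otimes> y)) (carrier G)" if y: "y \<in> carrier G" for y
    proof -
      have "T * \<rho> y = mat_sum n n (\<lambda>g. (h g \<cdot>\<^sub>m \<rho> g) * \<rho> y) (carrier G)"
        unfolding T_def using c y by (intro mat_sum_mult) auto
      also have "\<dots> = mat_sum n n (\<lambda>g. h g \<cdot>\<^sub>m \<rho> (g \<otimes> y)) (carrier G)"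
        using c y by (intro mat_sum_cong) (simp add: representation_mult[OF \<rho>r] mult_smult_assoc_mat[of _ n n _ n])
      finally show ?thesis .
    qed
    have comm: "\<rho> y * T = T * \<rho> y" if y: "y \<in> carrier G" for y
    proof -
      have "\<rho> y * T = mat_sum n n (\<lambda>g. \<rho> y * (h g \<cdot>\<^sub>m \<rho> g)) (carrier G)"
        unfolding T_def using c y by (intro mult_mat_sum) auto
      also have "\<dots> = mat_sum n n (\<lambda>g. h (y \<otimes> g \<otimes> inv y) \<cdot>\<^sub>m \<rho> ((y \<otimes> g \<otimes> inv y) \<otimes> y)) (carrier G)"
      proof (rule mat_sum_cong)
        fix g assume g: "g \<in> carrier G"
        have "y \<otimes> g \<otimes> inv y \<otimes> y = y \<otimes> g" using y g by (simp add: m_assoc)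
        then show "\<rho> y * (h g \<cdot>\<^sub>m \<rho> g) = h (y \<otimes> g \<otimes> inv y) \<cdot>\<^sub>m \<rho> ((y \<otimes> g \<otimes> inv y) \<otimes> y)"
          using c[OF y] c[OF g] y g
          by (simp add: conj_invariant representation_mult[OF \<rho>r] mult_smult_distrib[of _ n n _ n])
      qed
      also have "\<dots> = T * \<rho> y"
        unfolding T_right[OF y] by (rule mat_sum_reindex[OF bij_betw_conjugation[OF y], symmetric])
      finally show ?thesis .
    qed
    obtain t where t: "T = t \<cdot>\<^sub>m 1\<^sub>m n" using schur_scalar[OF \<rho> T comm] .
    have "t * of_nat n = mat_trace T" by (simp add: t mat_trace_smult_one)
    also have "\<dots> = (\<Sum>g\<in>carrier G. h g * \<psi> g)"
      unfolding T_def using c by (subst mat_trace_mat_sum) (auto simp: \<psi> character_of_def mat_trace_smult[of _ n])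
    also have "\<dots> = 0" using orth[OF that] .
    finally have "t = 0" using n by simp
    then have T0: "T = 0\<^sub>m n n" unfolding t by (intro eq_matI) auto
    have "(\<Sum>g\<in>carrier G. h (g \<otimes> x) * \<psi> g) = (\<Sum>g\<in>carrier G. h (g \<otimes> x) * \<psi> (g \<otimes> x \<otimes> inv x))"
      using x by (intro sum.cong) (auto simp: m_assoc)
    also have "\<dots> = (\<Sum>g\<in>carrier G. h g * \<psi> (g \<otimes> inv x))"
      by (rule sum.reindex_bij_betw[OF bij_betw_mult_right[OF x]])
    also have "\<dots> = (\<Sum>g\<in>carrier G. mat_trace (h g \<cdot>\<^sub>m \<rho> (g \<otimes> inv x)))"
      using c x by (intro sum.cong) (auto simp: \<psi> character_of_def mat_trace_smult[of _ n])
    also have "\<dots> = mat_trace (T * \<rho> (inv x))"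
      unfolding T_right[OF inv_closed[OF x]] using c x by (intro mat_trace_mat_sum[symmetric]) auto
    also have "\<dots> = 0" unfolding T0 using c[OF inv_closed[OF x]] by (simp add: mat_trace_def)
    finally show ?thesis .
  qed
  from orthogonal_to_Irr_imp_zero_at_one[OF this] x show ?thesis by simp
qed

section \<open>Values of irreducible characters\<close>

lemma Irr_afforded:
  assumes "\<chi> \<in> Irr G"
  shows "\<exists>n \<rho>. irreducible_representation G n \<rho> \<and> representation G n \<rho> \<and>
    (\<forall>g\<in>carrier G. \<chi> g = mat_trace (\<rho> g)) \<and> n > 0"
proof -
  obtain n \<rho> where "irreducible_representation G n \<rho>" "\<chi> = character_of G \<rho>"
    using assms by (auto simp: Irr_def)
  then show ?thesis
    by (intro exI[of _ n] exI[of _ \<rho>]) (simp add: irreducible_representation_def character_of_def)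
qed

lemma Irr_one:
  assumes "\<chi> \<in> Irr G"
  obtains n where "n > 0" "\<chi> \<one> = of_nat n"
proof -
  obtain n \<rho> where "representation G n \<rho>" "\<chi> \<one> = mat_trace (\<rho> \<one>)" "n > 0"
    using Irr_afforded[OF assms] by blast
  then show ?thesis by (intro that[of n]) (simp_all add: representation_one mat_trace_one)
qed

lemma Irr_one_nonzero: "\<chi> \<in> Irr G \<Longrightarrow> \<chi> \<one> \<noteq> 0"
  by (metis Irr_one of_nat_0_less_iff of_nat_eq_0_iff less_irrefl)

lemma Irr_conjugation_invariant:
  assumes "\<chi> \<in> Irr G" and xg: "x \<in> carrier G" "g \<in> carrier G"
  shows "\<chi> (x \<otimes> g \<otimes> inv x) = \<chi> g"
proof -
  obtain n \<rho> where \<rho>: "representation G n \<rho>" and \<chi>: "\<And>g. g \<in> carrier G \<Longrightarrow> \<chi> g = mat_trace (\<rho> g)"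
    using Irr_afforded[OF assms(1)] by blast
  have "mat_trace (\<rho> x * \<rho> g * \<rho> (inv x)) = mat_trace (\<rho> g)"
    using representation_carrier[OF \<rho>] representation_inv[OF \<rho>] xg
    by (intro mat_trace_conjugate[of _ n]) auto
  then show ?thesis using xg by (simp add: \<chi> representation_mult[OF \<rho>])
qed

text \<open>
  By Lagrange's theorem \<open>g\<close> has finite order, so the representing matrix has finite order as well,
  and \<open>g\<^sup>-\<^sup>1\<close> is a nonnegative power of \<open>g\<close>.
\<close>

lemma Irr_inv:
  assumes "\<chi> \<in> Irr G" and g: "g \<in> carrier G"
  shows "\<chi> (inv g) = cnj (\<chi> g)"
proof -
  obtain n \<rho> where \<rho>: "representation G n \<rho>" and \<chi>: "\<And>g. g \<in> carrier G \<Longrightarrow> \<chi> g = mat_trace (\<rho> g)"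
    using Irr_afforded[OF assms(1)] by blast
  have pow: "\<rho> (g [^] j) = \<rho> g ^\<^sub>m j" for j :: nat
    using g representation_carrier[OF \<rho> g]
    by (induction j) (auto simp: representation_one[OF \<rho>] representation_mult[OF \<rho>])
  have "Coset.order G > 0" using finite_carrier by (simp add: order_gt_0_iff_finite)
  then obtain k where k: "Coset.order G = Suc k" using gr0_implies_Suc by blast
  have 1: "g [^] Suc k = \<one>" using pow_order_eq_1[OF g] k by simp
  then have inv: "inv g = g [^] k" using g by (intro inv_equality) auto
  have "\<rho> g ^\<^sub>m Suc k = 1\<^sub>m n" unfolding pow[symmetric] 1 by (rule representation_one[OF \<rho>])
  from cnj_mat_trace_finite_order[OF representation_carrier[OF \<rho> g] this]
  have "mat_trace (\<rho> (inv g)) = cnj (mat_trace (\<rho> g))" by (simp add: inv pow)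
  then show ?thesis using g by (simp add: \<chi>)
qed

lemma constant_one_Irr: "(\<lambda>g\<in>carrier G. 1) \<in> Irr G"
proof -
  have rep: "representation G 1 (\<lambda>g. 1\<^sub>m 1)" by (simp add: representation_iff)
  have "W = {0\<^sub>v 1} \<or> W = carrier_vec 1" if "invariant_subspace G 1 (\<lambda>g. 1\<^sub>m 1) W" for W
  proof (rule disjCI)
    assume ne: "W \<noteq> carrier_vec 1"
    have W: "W \<subseteq> carrier_vec 1" "0\<^sub>v 1 \<in> W" "\<And>c v. v \<in> W \<Longrightarrow> c \<cdot>\<^sub>v v \<in> W"
      using that by (auto simp: invariant_subspace_iff)
    have "v = 0\<^sub>v 1" if v: "v \<in> W" for v
    proof (rule ccontr)
      assume "v \<noteq> 0\<^sub>v 1"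
      moreover have vc: "v \<in> carrier_vec 1" using v W(1) by auto
      ultimately have v0: "v $ 0 \<noteq> 0" by (auto simp: vec_eq_iff)
      have "w \<in> W" if "w \<in> carrier_vec 1" for w
      proof -
        have "w = (w $ 0 / v $ 0) \<cdot>\<^sub>v v" using v0 vc that by (intro eq_vecI) auto
        then show ?thesis using W(3)[OF v] by metis
      qed
      with W(1) ne show False by blast
    qed
    then show "W = {0\<^sub>v 1}" using W(2) by blast
  qed
  then have "irreducible_representation G 1 (\<lambda>g. 1\<^sub>m 1)"
    using rep by (simp add: irreducible_representation_def)
  moreover have "character_of G (\<lambda>g. 1\<^sub>m 1) = (\<lambda>g\<in>carrier G. 1)"
    by (simp add: character_of_def mat_trace_one)
  ultimately show ?thesis unfolding Irr_def by force
qed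

text \<open>
  The average of a representation over a subgroup is idempotent: it projects onto the fixed vectors.
  Its trace is the multiplicity of the trivial character of \<open>H\<close>.
\<close>

lemma sum_Irr_subgroup:
  assumes "\<chi> \<in> Irr G" and H: "subgroup H G"
  shows "(\<Sum>g\<in>H. \<chi> g) / of_nat (card H) \<in> \<nat>"
proof -
  obtain n \<rho> where \<rho>: "representation G n \<rho>" and \<chi>: "\<And>g. g \<in> carrier G \<Longrightarrow> \<chi> g = mat_trace (\<rho> g)"
    using Irr_afforded[OF assms(1)] by blast
  note c = representation_carrier[OF \<rho>]
  have HG: "H \<subseteq> carrier G" using H by (rule subgroup.subset)
  then have finH: "finite H" using finite_carrier finite_subset by blast
  have H0: "card H \<noteq> 0" using finH subgroup.one_closed[OF H] by auto
  define S where "S = mat_sum n n \<rho> H"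
  have S: "S \<in> carrier_mat n n" by (simp add: S_def)
  have S_mult: "S * \<rho> x = S" if x: "x \<in> H" for x
  proof -
    have xG: "x \<in> carrier G" using x HG by auto
    have bij: "bij_betw (\<lambda>g. g \<otimes> x) H H"
      using HG xG subgroup.m_closed[OF H] subgroup.m_inv_closed[OF H] x
      by (intro bij_betwI[of _ _ _ "\<lambda>g. g \<otimes> inv x"]) (auto simp: m_assoc subset_iff)
    have "S * \<rho> x = mat_sum n n (\<lambda>g. \<rho> g * \<rho> x) H"
      unfolding S_def using c HG xG by (intro mat_sum_mult) auto
    also have "\<dots> = mat_sum n n (\<lambda>g. \<rho> (g \<otimes> x)) H"
      using HG xG by (intro mat_sum_cong) (auto simp: representation_mult[OF \<rho>])
    also have "\<dots> = S" unfolding S_def by (rule mat_sum_reindex[OF bij, symmetric])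
    finally show ?thesis .
  qed
  have "S * S = mat_sum n n (\<lambda>g. S * \<rho> g) H"
    using mult_mat_sum[OF S, of H \<rho> n] c HG by (auto simp: S_def)
  also have "\<dots> = mat_sum n n (\<lambda>g. S) H" by (intro mat_sum_cong S_mult)
  also have "\<dots> = of_nat (card H) \<cdot>\<^sub>m S"
    using S by (intro eq_matI) auto
  finally have SS: "S * S = of_nat (card H) \<cdot>\<^sub>m S" .
  define E where "E = (1 / of_nat (card H)) \<cdot>\<^sub>m S"
  have E: "E \<in> carrier_mat n n" using S by (simp add: E_def)
  have "E * E = (1 / of_nat (card H)) \<cdot>\<^sub>m ((1 / of_nat (card H)) \<cdot>\<^sub>m (S * S))"
    unfolding E_def using S by (simp add: mult_smult_distrib[of _ n n _ n] mult_smult_assoc_mat[of _ n n _ n])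
  also have "\<dots> = E" unfolding SS E_def using H0 S by (intro eq_matI) auto
  finally have "mat_trace E \<in> \<nat>" using E by (intro mat_trace_idempotent)
  moreover have "mat_trace E = mat_trace S / of_nat (card H)"
    using S by (simp add: E_def mat_trace_def sum_divide_distrib)
  moreover have "mat_trace S = (\<Sum>g\<in>H. \<chi> g)"
    unfolding S_def using c HG by (subst mat_trace_mat_sum) (auto simp: \<chi> subset_iff intro!: sum.cong)
  ultimately show ?thesis by simp
qed

section \<open>The center\<close>

lemma one_in_center: "\<one> \<in> center G"
  by (simp add: center_def)

lemma center_subset: "center G \<subseteq> carrier G"
  by (auto simp: center_def)

lemma center_subgroup: "subgroup (center G) G"
proof (rule subgroupI)
  show "center G \<noteq> {}" by (auto simp: center_def intro!: exI[of _ \<one>])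
next
  fix z assume z: "z \<in> center G"
  then have zG: "z \<in> carrier G" using center_subset by auto
  have "inv z \<otimes> g = g \<otimes> inv z" if g: "g \<in> carrier G" for g
  proof -
    have "inv z \<otimes> g = inv (inv g \<otimes> z)" using zG g by (simp add: inv_mult_group)
    also have "inv g \<otimes> z = z \<otimes> inv g" using z g by (simp add: center_def)
    also have "inv (z \<otimes> inv g) = g \<otimes> inv z" using zG g by (simp add: inv_mult_group)
    finally show ?thesis .
  qed
  then show "inv z \<in> center G" using zG by (simp add: center_def)
next
  fix y z assume "y \<in> center G" "z \<in> center G"
  then have yz: "y \<in> carrier G" "z \<in> carrier G"
    and comm: "\<And>g. g \<in> carrier G \<Longrightarrow> y \<otimes> g = g \<otimes> y" "\<And>g. g \<in> carrier G \<Longrightarrow> z \<otimes> g = g \<otimes> z"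
    by (auto simp: center_def)
  have "y \<otimes> z \<otimes> g = g \<otimes> (y \<otimes> z)" if g: "g \<in> carrier G" for g
  proof -
    have "y \<otimes> z \<otimes> g = y \<otimes> (g \<otimes> z)" using yz g by (simp add: m_assoc comm(2)[OF g])
    also have "\<dots> = g \<otimes> y \<otimes> z" using yz g by (simp add: comm(1)[OF g] flip: m_assoc)
    finally show ?thesis using yz g by (simp add: m_assoc)
  qed
  then show "y \<otimes> z \<in> center G" using yz by (simp add: center_def)
qed (auto simp: center_def)

lemma order_eq_rcosets_center: "card (rcosets (center G)) * card (center G) = Coset.order G"
  by (rule lagrange[OF center_subgroup])

lemma center_of_card_two:
  assumes "card (center G) = 2"
  shows "\<exists>z. z \<noteq> \<one> \<and> center G = {\<one>, z}"
proof -
  obtain x y where "center G = {x, y}" "x \<noteq> y" using assms by (auto simp: card_2_iff)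
  moreover have "\<one> = x \<or> \<one> = y" using one_in_center calculation(1) by simp
  ultimately show ?thesis by (metis insert_commute)
qed

lemma center_of_order_two:
  assumes "center G = {\<one>, z}" "z \<noteq> \<one>"
  shows "z \<in> carrier G" "z \<otimes> z = \<one>" "inv z = z"
proof -
  show z: "z \<in> carrier G" using assms center_subset by auto
  have "z \<otimes> z \<in> {\<one>, z}" using subgroup.m_closed[OF center_subgroup, of z z] assms by auto
  then show zz: "z \<otimes> z = \<one>" using z assms(2) by auto
  then show "inv z = z" using z by (intro inv_equality)
qed

text \<open>
  A central element commutes with everything, so Schur's lemma represents it by a scalar. The scalar is
  nonzero since \<open>z\<close> is invertible.
\<close>

lemma Irr_central_scalar:
  assumes "\<chi> \<in> Irr G" and z: "z \<in> center G"
  obtains c where "c \<noteq> 0" "\<And>g. g \<in> carrier G \<Longrightarrow> \<chi> (z \<otimes> g) = c * \<chi> g"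
proof -
  obtain n \<rho> where irr: "irreducible_representation G n \<rho>" and \<rho>: "representation G n \<rho>"
    and \<chi>: "\<And>g. g \<in> carrier G \<Longrightarrow> \<chi> g = mat_trace (\<rho> g)" and n: "n > 0"
    using Irr_afforded[OF assms(1)] by blast
  have zG: "z \<in> carrier G" and zc: "\<And>g. g \<in> carrier G \<Longrightarrow> z \<otimes> g = g \<otimes> z"
    using z by (auto simp: center_def)
  note c = representation_carrier[OF \<rho>]
  have "\<rho> g * \<rho> z = \<rho> z * \<rho> g" if "g \<in> carrier G" for g
    using that zG zc by (metis representation_mult[OF \<rho>])
  then obtain t where t: "\<rho> z = t \<cdot>\<^sub>m 1\<^sub>m n"
    using schur_scalar[OF irr c[OF zG]] by blast
  have eq: "\<chi> (z \<otimes> g) = t * \<chi> g" if g: "g \<in> carrier G" for g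
  proof -
    have "\<rho> (z \<otimes> g) = t \<cdot>\<^sub>m \<rho> g"
      using c[OF g] by (simp add: representation_mult[OF \<rho> zG g] t mult_smult_assoc_mat[of _ n n _ n])
    then show ?thesis using g zG c[OF g] by (simp add: \<chi> mat_trace_def sum_distrib_left)
  qed
  have "\<chi> \<one> = t * \<chi> (inv z)" using eq[of "inv z"] zG by simp
  moreover have "\<chi> \<one> \<noteq> 0" using assms(1) by (rule Irr_one_nonzero)
  ultimately have "t \<noteq> 0" by auto
  then show ?thesis using eq by (rule that)
qed

section \<open>Two columns that differ in one entry\<close>

text \<open>
  The number of \<open>x\<close> that conjugate \<open>a\<close> to \<open>g\<close>. This is the order of the centralizer of \<open>a\<close> times the
  indicator of the class of \<open>a\<close>, but as a sum over the group it can be handled by substitution alone.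
\<close>

definition conj_count :: "'a \<Rightarrow> 'a \<Rightarrow> complex" where
  "conj_count a g = (\<Sum>x\<in>carrier G. if x \<otimes> a \<otimes> inv x = g then 1 else 0)"

lemma conj_count_conjugation_invariant:
  assumes "a \<in> carrier G" "y \<in> carrier G" "g \<in> carrier G"
  shows "conj_count a (y \<otimes> g \<otimes> inv y) = conj_count a g"
proof -
  have "conj_count a (y \<otimes> g \<otimes> inv y) =
      (\<Sum>x\<in>carrier G. if (y \<otimes> x) \<otimes> a \<otimes> inv (y \<otimes> x) = y \<otimes> g \<otimes> inv y then 1 else 0)"
    unfolding conj_count_def by (rule sum.reindex_bij_betw[OF bij_betw_mult_left[OF assms(2)], symmetric])
  also have "\<dots> = conj_count a g"
    unfolding conj_count_def
  proof (intro sum.cong refl if_cong)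
    fix x assume x: "x \<in> carrier G"
    have "(y \<otimes> x) \<otimes> a \<otimes> inv (y \<otimes> x) = y \<otimes> (x \<otimes> a \<otimes> inv x) \<otimes> inv y"
      using assms x by (simp add: inv_mult_group m_assoc)
    then show "((y \<otimes> x) \<otimes> a \<otimes> inv (y \<otimes> x) = y \<otimes> g \<otimes> inv y) = (x \<otimes> a \<otimes> inv x = g)"
      using assms x by simp
  qed
  finally show ?thesis .
qed

lemma sum_conj_count_mult:
  assumes "\<psi> \<in> Irr G" "a \<in> carrier G"
  shows "(\<Sum>g\<in>carrier G. conj_count a g * \<psi> g) = of_nat (card (carrier G)) * \<psi> a"
proof -
  have "(\<Sum>g\<in>carrier G. conj_count a g * \<psi> g) =
      (\<Sum>x\<in>carrier G. \<Sum>g\<in>carrier G. (if x \<otimes> a \<otimes> inv x = g then 1 else 0) * \<psi> g)"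
    unfolding conj_count_def sum_distrib_right by (rule sum.swap)
  also have "\<dots> = (\<Sum>x\<in>carrier G. \<Sum>g\<in>carrier G. if x \<otimes> a \<otimes> inv x = g then \<psi> g else 0)"
    by (intro sum.cong) auto
  also have "\<dots> = (\<Sum>x\<in>carrier G. \<psi> a)"
    using assms finite_carrier by (intro sum.cong) (auto simp: Irr_conjugation_invariant)
  finally show ?thesis by simp
qed

lemma conj_count_central:
  assumes "a \<in> center G"
  shows "conj_count a g = (if g = a then of_nat (card (carrier G)) else 0)"
proof -
  have aG: "a \<in> carrier G" using assms center_subset by auto
  have "x \<otimes> a \<otimes> inv x = a" if x: "x \<in> carrier G" for x
  proof -
    have "x \<otimes> a = a \<otimes> x" using assms x by (simp add: center_def)
    then show ?thesis using x aG by (simp add: m_assoc)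
  qed
  then show ?thesis by (auto simp: conj_count_def)
qed

text \<open>
  A central element is conjugate only to itself.
\<close>

lemma conj_count_at_central:
  assumes "a \<in> carrier G" "z \<in> center G" "conj_count a z \<noteq> 0"
  shows "a = z"
proof -
  have "\<exists>x\<in>carrier G. x \<otimes> a \<otimes> inv x = z"
  proof (rule ccontr)
    assume "\<not> (\<exists>x\<in>carrier G. x \<otimes> a \<otimes> inv x = z)"
    then have "conj_count a z = 0" unfolding conj_count_def by (intro sum.neutral) simp
    with assms(3) show False by simp
  qed
  then obtain x where x: "x \<in> carrier G" "x \<otimes> a \<otimes> inv x = z" by blast
  have "z \<otimes> x = x \<otimes> a" unfolding x(2)[symmetric] using x(1) assms(1) by (simp add: m_assoc)
  also have "z \<otimes> x = x \<otimes> z" using assms(2) x(1) by (simp add: center_def)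
  finally show ?thesis using x(1) assms(1,2) center_subset by auto
qed

text \<open>
  Both sides are class functions of \<open>g\<close> with the same inner products with all irreducible characters:
  by hypothesis only \<open>\<chi>\<close> contributes on the left. This is the column
  orthogonality relation, for the columns of \<open>a\<close> and \<open>b\<close> subtracted from each other.
\<close>

lemma column_difference:
  assumes \<chi>: "\<chi> \<in> Irr G" and ab: "a \<in> carrier G" "b \<in> carrier G"
    and agree: "\<And>\<psi>. \<psi> \<in> Irr G - {\<chi>} \<Longrightarrow> \<psi> a = \<psi> b" and g: "g \<in> carrier G"
  shows "conj_count a g - conj_count b g = (\<chi> a - \<chi> b) * \<chi> (inv g)"
proof -
  define t where "t = \<chi> a - \<chi> b"
  define h where "h g = conj_count a g - conj_count b g - t * \<chi> (inv g)" for g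
  have "h g = 0"
  proof (rule class_function_orthogonal_to_Irr_eq_zero[OF _ _ g])
    fix x y assume xy: "x \<in> carrier G" "y \<in> carrier G"
    have "inv (x \<otimes> y \<otimes> inv x) = x \<otimes> inv y \<otimes> inv x" using xy by (simp add: inv_mult_group m_assoc)
    then show "h (x \<otimes> y \<otimes> inv x) = h y"
      using xy ab \<chi> by (simp add: h_def conj_count_conjugation_invariant Irr_conjugation_invariant)
  next
    fix \<psi> assume \<psi>: "\<psi> \<in> Irr G"
    have "(\<Sum>g\<in>carrier G. h g * \<psi> g) = (\<Sum>g\<in>carrier G. conj_count a g * \<psi> g)
        - (\<Sum>g\<in>carrier G. conj_count b g * \<psi> g) - t * (\<Sum>g\<in>carrier G. \<chi> (inv g) * \<psi> g)"
      by (simp add: h_def left_diff_distrib sum_subtractf sum_distrib_left mult.assoc)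
    also have "(\<Sum>g\<in>carrier G. \<chi> (inv g) * \<psi> g) = (\<Sum>g\<in>carrier G. \<psi> g * \<chi> (inv g))"
      by (simp only: mult.commute)
    also have "(\<Sum>g\<in>carrier G. conj_count a g * \<psi> g) - (\<Sum>g\<in>carrier G. conj_count b g * \<psi> g)
        - t * \<dots> = of_nat (card (carrier G)) * (\<psi> a - \<psi> b)
        - t * (if \<psi> = \<chi> then of_nat (card (carrier G)) else 0)"
      using \<psi> \<chi> ab by (simp only: sum_conj_count_mult first_orthogonality right_diff_distrib)
    also have "\<dots> = 0" using agree[of \<psi>] \<psi> by (cases "\<psi> = \<chi>") (simp_all add: t_def)
    finally show "(\<Sum>g\<in>carrier G. h g * \<psi> g) = 0" .
  qed
  then have "conj_count a g - conj_count b g = t * \<chi> (inv g)" by (simp add: h_def)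
  then show ?thesis by (simp only: t_def)
qed

text \<open>
  Evaluate the difference of the columns at 1, where \<open>\<chi>\<close> does not vanish.
\<close>

lemma CD1_pair_contains_one:
  assumes \<chi>: "\<chi> \<in> Irr G" and ab: "a \<in> carrier G" "b \<in> carrier G" and ne: "\<chi> a \<noteq> \<chi> b"
    and agree: "\<And>\<psi>. \<psi> \<in> Irr G - {\<chi>} \<Longrightarrow> \<psi> a = \<psi> b"
  shows "a = \<one> \<or> b = \<one>"
proof -
  have "\<chi> \<one> \<noteq> 0" using \<chi> by (rule Irr_one_nonzero)
  with column_difference[OF \<chi> ab agree one_closed] ne
  have "conj_count a \<one> \<noteq> 0 \<or> conj_count b \<one> \<noteq> 0" by auto
  then show ?thesis
    using conj_count_at_central[OF ab(1) one_in_center] conj_count_at_central[OF ab(2) one_in_center] by argo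
qed

text \<open>
  Now \<open>(\<chi>(1) - \<chi>(b)) \<chi>(g\<^sup>-\<^sup>1)\<close> is \<open>|G|\<close> at \<open>g = 1\<close> and otherwise nonzero only on the class of \<open>b\<close>.
  Since \<open>\<chi>\<close> does not vanish on the center, every nontrivial central element is \<open>b\<close>. Adding the values
  at 1 and at \<open>b\<close>, which are opposite, gives \<open>\<chi>(b) = - \<chi>(1)\<close>.
\<close>

lemma CD1_pair_with_one:
  assumes \<chi>: "\<chi> \<in> Irr G" and b: "b \<in> carrier G" and ne: "\<chi> \<one> \<noteq> \<chi> b"
    and agree: "\<And>\<psi>. \<psi> \<in> Irr G - {\<chi>} \<Longrightarrow> \<psi> \<one> = \<psi> b" and Z: "center G \<noteq> {\<one>}"
  shows "b \<noteq> \<one>" "center G = {\<one>, b}" "\<And>g. g \<in> carrier G - center G \<Longrightarrow> \<chi> g = 0"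
    "of_nat (Coset.order G) = 2 * (\<chi> \<one>)\<^sup>2"
proof -
  show b1: "b \<noteq> \<one>" using ne by auto
  have diff: "conj_count \<one> g - conj_count b g = (\<chi> \<one> - \<chi> b) * \<chi> (inv g)" if "g \<in> carrier G" for g
    using column_difference[OF \<chi> one_closed b agree that] .
  have \<chi>1: "\<chi> \<one> \<noteq> 0" using \<chi> by (rule Irr_one_nonzero)
  have "z = b" if z: "z \<in> center G" "z \<noteq> \<one>" for z
  proof -
    have zG: "z \<in> carrier G" using z center_subset by auto
    have inv: "inv z \<in> center G" using subgroup.m_inv_closed[OF center_subgroup z(1)] .
    obtain c where c: "c \<noteq> 0" "\<And>g. g \<in> carrier G \<Longrightarrow> \<chi> (inv z \<otimes> g) = c * \<chi> g"
      using Irr_central_scalar[OF \<chi> inv] by blast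
    have "\<chi> (inv z) \<noteq> 0" using c(2)[OF one_closed] c(1) \<chi>1 zG by simp
    moreover have "conj_count \<one> z = 0" using z(2) by (simp add: conj_count_central[OF one_in_center])
    ultimately have "conj_count b z \<noteq> 0" using diff[OF zG] ne by auto
    then show ?thesis using conj_count_at_central[OF b z(1)] by simp
  qed
  then show Zb: "center G = {\<one>, b}" using Z one_in_center by blast
  note bb = center_of_order_two[OF Zb b1]
  have bZ: "b \<in> center G" using Zb by simp
  have diff': "(\<chi> \<one> - \<chi> b) * \<chi> (inv g) =
      (if g = \<one> then of_nat (Coset.order G) else if g = b then - of_nat (Coset.order G) else 0)" if "g \<in> carrier G" for g
    unfolding diff[OF that, symmetric] using b1
    by (simp add: conj_count_central[OF one_in_center] conj_count_central[OF bZ] Coset.order_def)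
  show van: "\<chi> g = 0" if g: "g \<in> carrier G - center G" for g
  proof -
    have gG: "g \<in> carrier G" using g by auto
    have "inv g \<notin> center G"
      using subgroup.m_inv_closed[OF center_subgroup, of "inv g"] g by auto
    then have "inv g \<noteq> \<one>" "inv g \<noteq> b" using Zb by auto
    then have "(\<chi> \<one> - \<chi> b) * \<chi> g = 0" using diff'[OF inv_closed[OF gG]] gG by simp
    then show ?thesis using ne by simp
  qed
  have "(\<chi> \<one> - \<chi> b) * \<chi> \<one> = of_nat (Coset.order G)" using diff'[OF one_closed] by simp
  moreover have "(\<chi> \<one> - \<chi> b) * \<chi> b = - of_nat (Coset.order G)" using diff'[OF b] b1 bb(3) by simp
  ultimately have "(\<chi> \<one> - \<chi> b) * (\<chi> \<one> + \<chi> b) = 0" by (simp add: distrib_left)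
  then have "\<chi> b = - \<chi> \<one>" using ne by (simp add: add_eq_0_iff)
  then show "of_nat (Coset.order G) = 2 * (\<chi> \<one>)\<^sup>2"
    using \<open>(\<chi> \<one> - \<chi> b) * \<chi> \<one> = of_nat (Coset.order G)\<close> by (simp add: power2_eq_square mult.assoc)
qed

section \<open>Groups of central type with a center of order two\<close>

text \<open>
  If \<open>\<chi>\<close> vanishes on the nontrivial elements of a Sylow subgroup \<open>P\<close>, then \<open>|P|\<close> divides \<open>\<chi>(1)\<close>.
  For an odd prime divisor of \<open>|G|\<close> this contradicts \<open>|G| = 2 \<chi>(1)\<^sup>2\<close>, in which the exponent of that prime is twice
  its exponent in \<open>\<chi>(1)\<close>.
\<close>

lemma two_group_if_vanishing_off_center:
  assumes \<chi>: "\<chi> \<in> Irr G" and Z: "card (center G) = 2"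
    and van: "\<And>g. g \<in> carrier G - center G \<Longrightarrow> \<chi> g = 0"
    and ord: "of_nat (Coset.order G) = 2 * (\<chi> \<one>)\<^sup>2"
  shows "\<exists>k. Coset.order G = 2 ^ k"
proof -
  obtain n where n: "n > 0" "\<chi> \<one> = of_nat n" using \<chi> by (rule Irr_one)
  have "of_nat (Coset.order G) = (of_nat (2 * n\<^sup>2) :: complex)" using ord n by simp
  then have ord_n: "Coset.order G = 2 * n\<^sup>2" by (simp only: of_nat_eq_iff)
  have odd_prime: "p = 2" if p: "prime p" "p dvd Coset.order G" for p :: nat
  proof (rule ccontr)
    assume "p \<noteq> 2"
    then have "odd p" using p(1) primes_dvd_imp_eq two_is_prime_nat by blast
    define a where "a = multiplicity p (Coset.order G)"
    have "Coset.order G \<noteq> 0" using n ord_n by simp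
    then obtain m where m: "Coset.order G = p ^ a * m" "\<not> p dvd m"
      using multiplicity_decompose'[of "Coset.order G" p] prime_gt_Suc_0_nat[OF p(1)]
      unfolding a_def by (metis less_irrefl nat_dvd_1_iff_1 One_nat_def)
    have a0: "a > 0" using p(2) m by (cases a) auto
    obtain P where P: "subgroup P G" "card P = p ^ a"
      using sylow_thm[OF p(1) group_axioms m(1) finite_carrier] by blast
    have PG: "P \<subseteq> carrier G" using P(1) by (rule subgroup.subset)
    \<comment> \<open>A nontrivial central element is an involution, which a group of odd order does not contain.\<close>
    have "g \<notin> center G" if g: "g \<in> P" "g \<noteq> \<one>" for g
    proof
      assume gZ: "g \<in> center G"
      have "center G = {\<one>, g}"
        using center_of_card_two[OF Z] gZ g(2) by blast
      from center_of_order_two[OF this g(2)] have gg: "g \<in> carrier G" "g \<otimes> g = \<one>" by auto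
      interpret P: group "G\<lparr>carrier := P\<rparr>" using subgroup_imp_group[OF P(1)] .
      have "g [^] card P = \<one>"
        using P.pow_order_eq_1[of g] g(1) by (simp add: Coset.order_def flip: nat_pow_consistent)
      moreover have "g [^] (2 * j + 1) = g" for j :: nat
      proof (induction j)
        case (Suc j)
        have "g [^] (2 * Suc j + 1) = g [^] (2 * j + 1) \<otimes> (g \<otimes> g)"
          using gg(1) by (simp add: m_assoc)
        then show ?case using Suc gg by simp
      qed (use gg in simp)
      moreover have "odd (card P)" using P(2) \<open>odd p\<close> by simp
      ultimately show False using g(2) by (metis oddE)
    qed
    then have "(\<Sum>g\<in>P. \<chi> g) = (\<Sum>g\<in>{\<one>}. \<chi> g)"
      using PG van subgroup.one_closed[OF P(1)] finite_subset[OF PG finite_carrier]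
      by (intro sum.mono_neutral_right) auto
    then have "of_nat n / of_nat (p ^ a) \<in> (\<nat> :: complex set)"
      using sum_Irr_subgroup[OF \<chi> P(1)] n(2) P(2) by simp
    then obtain k where k: "of_nat n / of_nat (p ^ a) = (of_nat k :: complex)" by (auto elim: Nats_cases)
    have "p ^ a \<noteq> 0" using p(1) by (simp add: prime_gt_0_nat)
    then have "of_nat n = (of_nat (k * p ^ a) :: complex)" using k by (simp add: field_simps)
    then have nk: "n = k * p ^ a" by (simp only: of_nat_eq_iff)
    have "p ^ a * m = 2 * n\<^sup>2" using m(1) ord_n by (rule trans[OF sym])
    also have "\<dots> = p ^ a * (2 * k\<^sup>2 * p ^ a)" by (simp only: nk power2_eq_square mult_ac)
    finally have "p ^ a * m = p ^ a * (2 * k\<^sup>2 * p ^ a)" .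
    then have "m = 2 * k\<^sup>2 * p ^ a" using \<open>p ^ a \<noteq> 0\<close> by (metis mult_left_cancel)
    then show False using m(2) a0 by (simp add: dvd_mult)
  qed
  have "Coset.order G \<noteq> 0" using n ord_n by simp
  then obtain m where m: "Coset.order G = 2 ^ multiplicity 2 (Coset.order G) * m" "\<not> 2 dvd m"
    using multiplicity_decompose'[of "Coset.order G" 2] by auto
  have "m = 1"
  proof (rule ccontr)
    assume "m \<noteq> 1"
    then obtain p where "prime p" "p dvd m" using prime_factor_nat by blast
    then show False using odd_prime[of p] m by (metis dvd_mult)
  qed
  then show ?thesis using m(1) by auto
qed

lemma CD1_imp:
  assumes "CD1_group G" and Z: "center G \<noteq> {\<one>}"
  shows "two_group G \<and> central_type G \<and> card (center G) = 2"
proof -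
  obtain a b \<chi> where ab: "a \<in> carrier G" "b \<in> carrier G" and \<chi>: "\<chi> \<in> Irr G" and ne: "\<chi> a \<noteq> \<chi> b"
    and agree: "\<And>\<psi>. \<psi> \<in> Irr G - {\<chi>} \<Longrightarrow> \<psi> a = \<psi> b"
    using assms(1) by (auto simp: CD1_group_def)
  have "\<exists>y\<in>carrier G. \<chi> \<one> \<noteq> \<chi> y \<and> (\<forall>\<psi>\<in>Irr G - {\<chi>}. \<psi> \<one> = \<psi> y)"
    using CD1_pair_contains_one[OF \<chi> ab ne agree] ab ne agree by metis
  then obtain y where y: "y \<in> carrier G" "\<chi> \<one> \<noteq> \<chi> y" "\<And>\<psi>. \<psi> \<in> Irr G - {\<chi>} \<Longrightarrow> \<psi> \<one> = \<psi> y" by blast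
  note * = CD1_pair_with_one[OF \<chi> y Z]
  have card: "card (center G) = 2" using *(1,2) by simp
  have two: "two_group G"
    using two_group_if_vanishing_off_center[OF \<chi> card *(3,4)] group_axioms by (auto simp: two_group_def)
  have "of_nat (card (rcosets (center G)) * 2) = 2 * (\<chi> \<one>)\<^sup>2"
    using order_eq_rcosets_center *(4) by (simp only: card)
  then have "of_nat (card (rcosets (center G))) = (\<chi> \<one>)\<^sup>2" by simp
  then have "central_type G" using \<chi> by (auto simp: central_type_def)
  with two card show ?thesis by blast
qed

text \<open>
  The witnesses are 1, the nontrivial central element \<open>z\<close>, and the character of degree \<open>\<surd>[G:Z]\<close>.
\<close>

lemma central_type_imp_CD1:
  assumes "central_type G" and "card (center G) = 2" and big: "Coset.order G > 2"
  shows "CD1_group G"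
proof -
  obtain \<chi> where \<chi>: "\<chi> \<in> Irr G" and sq: "of_nat (card (rcosets (center G))) = (\<chi> \<one>)\<^sup>2"
    using assms(1) by (auto simp: central_type_def)
  obtain z where Zz: "center G = {\<one>, z}" and z1: "z \<noteq> \<one>"
    using center_of_card_two[OF assms(2)] by blast
  note z = center_of_order_two[OF Zz z1]
  have zZ: "z \<in> center G" using Zz by simp
  have "Coset.order G = card (rcosets (center G)) * 2"
    using order_eq_rcosets_center assms(2) by simp
  then have ord: "of_nat (Coset.order G) = 2 * (\<chi> \<one>)\<^sup>2" using sq by simp
  have sgn: "\<psi> z = \<psi> \<one> \<or> \<psi> z = - \<psi> \<one>" if \<psi>: "\<psi> \<in> Irr G" for \<psi>
  proof -
    obtain c where c: "\<And>g. g \<in> carrier G \<Longrightarrow> \<psi> (z \<otimes> g) = c * \<psi> g"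
      using Irr_central_scalar[OF \<psi> zZ] by blast
    have "\<psi> \<one> = c * (c * \<psi> \<one>)" using c[OF one_closed] c[OF z(1)] z by simp
    moreover have "\<psi> \<one> \<noteq> 0" using \<psi> by (rule Irr_one_nonzero)
    ultimately have "c * c = 1" by simp
    then have "c = 1 \<or> c = - 1" by (simp add: square_eq_1_iff)
    then show ?thesis using c[OF one_closed] z(1) by auto
  qed
  have split: "(\<Sum>g\<in>carrier G. f g) = f \<one> + f z + (\<Sum>g\<in>carrier G - center G. f g)" for f :: "'a \<Rightarrow> 'c :: comm_monoid_add"
    using sum.subset_diff[OF center_subset finite_carrier, of f] z1
    by (simp add: Zz add.commute)
  have van: "\<chi> g = 0" if g: "g \<in> carrier G - center G" for g
  proof -
    have "(\<Sum>g\<in>carrier G. \<chi> g * \<chi> (inv g)) = of_nat (Coset.order G)"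
      using first_orthogonality[OF \<chi> \<chi>] by (simp add: Coset.order_def)
    also have "(\<Sum>g\<in>carrier G. \<chi> g * \<chi> (inv g)) = \<chi> \<one> * \<chi> \<one> + \<chi> z * \<chi> z
        + (\<Sum>g\<in>carrier G - center G. \<chi> g * \<chi> (inv g))"
      unfolding split by (simp add: z)
    also have "\<chi> z * \<chi> z = \<chi> \<one> * \<chi> \<one>" using sgn[OF \<chi>] by auto
    finally have "(\<Sum>g\<in>carrier G - center G. \<chi> g * \<chi> (inv g)) = 0"
      by (simp add: ord power2_eq_square)
    also have "(\<Sum>g\<in>carrier G - center G. \<chi> g * \<chi> (inv g)) =
        complex_of_real (\<Sum>g\<in>carrier G - center G. (norm (\<chi> g))\<^sup>2)"
      unfolding of_real_sum by (intro sum.cong refl) (simp add: Irr_inv[OF \<chi>] flip: complex_norm_square)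
    finally have "(\<Sum>g\<in>carrier G - center G. (norm (\<chi> g))\<^sup>2) = 0" by (simp only: of_real_eq_0_iff)
    then show ?thesis
      using g finite_carrier by (simp add: sum_nonneg_eq_0_iff)
  qed
  have \<chi>1: "\<chi> \<one> \<noteq> 0" using \<chi> by (rule Irr_one_nonzero)
  have \<chi>z: "\<chi> z = - \<chi> \<one>"
  proof (rule ccontr)
    assume "\<chi> z \<noteq> - \<chi> \<one>"
    then have eq: "\<chi> z = \<chi> \<one>" using sgn[OF \<chi>] by auto
    define u where "u = (\<lambda>g\<in>carrier G. 1 :: complex)"
    have "(\<Sum>g\<in>carrier G. \<chi> g * u (inv g)) = 2 * \<chi> \<one>"
      unfolding split using van z by (simp add: u_def eq)
    then have "\<chi> = u"
      using first_orthogonality[OF \<chi>, of u] constant_one_Irr \<chi>1 unfolding u_def[symmetric]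
      by (auto split: if_splits)
    then have "\<chi> \<one> = 1" by (simp add: u_def)
    then have "of_nat (Coset.order G) = (of_nat 2 :: complex)" using ord by simp
    then show False using big by (simp only: of_nat_eq_iff)
  qed
  have agree: "\<psi> \<one> = \<psi> z" if \<psi>: "\<psi> \<in> Irr G - {\<chi>}" for \<psi>
  proof -
    have "(\<Sum>g\<in>carrier G. \<chi> g * \<psi> (inv g)) = 0"
      using first_orthogonality[OF \<chi>, of \<psi>] \<psi> by auto
    moreover have "(\<Sum>g\<in>carrier G. \<chi> g * \<psi> (inv g)) = \<chi> \<one> * (\<psi> \<one> - \<psi> z)"
      unfolding split using van z by (simp add: \<chi>z right_diff_distrib)
    ultimately show ?thesis using \<chi>1 by simp
  qed
  have "\<chi> \<one> \<noteq> \<chi> z" using \<chi>1 \<chi>z by simp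
  moreover have "\<not> conjugate_in G \<one> z" using z1 by (auto simp: conjugate_in_def)
  ultimately show ?thesis
    unfolding CD1_group_def using group_axioms finite_carrier big \<chi> agree z(1) by blast
qed

end

theorem theorem3:
  fixes G :: "('a, 'b) monoid_scheme"
  assumes "group G" and "finite (carrier G)" and "Coset.order G > 2"
  shows "(CD1_group G \<and> center G \<noteq> {\<one>\<^bsub>G\<^esub>}) \<longleftrightarrow>
    (two_group G \<and> central_type G \<and> card (center G) = 2)"
proof -
  interpret finite_group G
    using assms by (simp add: finite_group_def finite_group_axioms_def)
  show ?thesis
    using CD1_imp central_type_imp_CD1 assms(3) by auto
qed

end
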